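(* Let $L$ be a frame and $X_L$ its Esakia space. Then the following conditions are equivalent: (1) The frame $N(L)$ of nuclei on $L$ is boolean. (2) $N(X_L)=\mathsf{RC}(X_L)$, i.e. the nuclear subsets of $X_L$ are exactly the regular closed subsets of $X_L$. (3) $\max(D)$ is clopen for each clopen downset $D$ of $X_L$. (4) $L$ is scattered.
   Context: A frame is a complete lattice satisfying $a\wedge\bigvee S=\bigvee\{a\wedge s\mid s\in S\}$; it is boolean if it is a boolean algebra. Frames are Heyting algebras with $a\to b=\bigvee\{x\mid a\wedge x\le b\}$ and $\lnot a=a\to 0$. A nucleus on a frame $L$ is a map $j:L\to L$ with $a\le ja$, $jja\le ja$, and $j(a\wedge b)=ja\wedge jb$ for all $a,b\in L$. $N(L)$ is the set of all nuclei on $L$ ordered by $j\le k$ iff $ja\le ka$ for all $a\in L$; it is a frame. The Esakia space $X_L$ of $L$ is the set of prime (proper) filters of $L$, ordered by inclusion, with the topology $\pi$ whose basis is $\{\varphi(a)\setminus\varphi(b)\mid a,b\in L\}$, where $\varphi(a)=\{x\in X_L\mid a\in x\}$. For $S\subseteq X_L$, ${\downarrow}S=\{x\mid x\le s\text{ for some }s\in S\}$; $S$ is a downset if $S={\downarrow}S$; $\max(S)$ is the set of maximal points of $S$. A closed subset $F$ of $X_L$ is nuclear if ${\downarrow}(U\cap F)$ is clopen for each clopen $U\subseteq X_L$. $N(X_L)$ is the set of nuclear subsets of $X_L$. $\mathsf{RC}(X_L)$ is the set of regular closed subsets of $(X_L,\pi)$ (sets equal to the closure of their interior). An element $d$ of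 a frame is dense if $\lnot d=0$. For $a\in L$, the principal upset ${\uparrow}a=\{b\in L\mid a\le b\}$ is a frame, and $d\ge a$ is dense in ${\uparrow}a$ iff $d\to a=a$. The frame $L$ is scattered if for each $a\in L$ the frame ${\uparrow}a$ has a smallest dense element. *)

theory Defs
  imports "HOL-Analysis.Analysis"
begin

section \<open>Frames\<close>

text \<open>Strictly weaker than the library class \<open>complete_distrib_lattice\<close>, which requires complete
  distributivity.\<close>

class frame = complete_lattice +
  assumes inf_Sup_distrib: "inf a (Sup S) = (SUP s\<in>S. inf a s)"
begin

subclass distrib_lattice
proof
  have "inf x (sup y z) = sup (inf x y) (inf x z)" for x y z
    using inf_Sup_distrib[of x "{y, z}"] by simp
  then show "sup x (inf y z) = inf (sup x y) (sup x z)" for x y z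
    by (rule distrib_imp1)
qed

definition himp :: "'a \<Rightarrow> 'a \<Rightarrow> 'a"
  where "himp a b = Sup {x. inf a x \<le> b}"

lemma le_himp_iff: "x \<le> himp a b \<longleftrightarrow> inf a x \<le> b"
proof
  assume "x \<le> himp a b"
  then have "inf a x \<le> inf a (himp a b)"
    by (rule inf_mono[OF order_refl])
  also have "\<dots> \<le> b"
    by (auto simp: himp_def inf_Sup_distrib intro: SUP_least)
  finally show "inf a x \<le> b" .
qed (auto simp: himp_def intro: Sup_upper)

end

text \<open>The library's \<open>boolean_algebra\<close> carries complement and difference as operations; here
  they are asked to exist on top of the given lattice structure.\<close>

definition boolean_frame :: "'a::frame itself \<Rightarrow> bool"
  where "boolean_frame _ \<longleftrightarrow>
    (\<exists>(minus :: 'a \<Rightarrow> 'a \<Rightarrow> 'a) uminus.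
      class.boolean_algebra minus uminus inf (\<le>) (<) sup bot top)"

text \<open>The pseudocomplement of \<open>d\<close> is computed inside the frame \<open>{a..}\<close>, whose bottom element
  is \<open>a\<close>. The join in \<open>{a..}\<close> of a nonempty subset is its join in the ambient frame, and the set
  below contains \<open>a\<close>.\<close>

definition dense_in_upset :: "'a::frame \<Rightarrow> 'a \<Rightarrow> bool"
  where "dense_in_upset a d \<longleftrightarrow> d \<in> {a..} \<and> Sup {x \<in> {a..}. inf d x \<le> a} = a"

lemma dense_in_upset_iff: "dense_in_upset a d \<longleftrightarrow> a \<le> d \<and> himp d a = a"
proof -
  have "Sup {x \<in> {a..}. inf d x \<le> a} = himp d a"
  proof (rule antisym)
    show "Sup {x \<in> {a..}. inf d x \<le> a} \<le> himp d a"
      by (rule Sup_least) (simp add: le_himp_iff)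
    have "a \<le> himp d a" and "inf d (himp d a) \<le> a"
      by (simp_all add: le_himp_iff flip: le_himp_iff[of "himp d a"])
    then show "himp d a \<le> Sup {x \<in> {a..}. inf d x \<le> a}"
      by (intro Sup_upper) simp
  qed
  then show ?thesis
    by (simp add: dense_in_upset_def)
qed

definition scattered_frame :: "'a::frame itself \<Rightarrow> bool"
  where "scattered_frame _ \<longleftrightarrow>
    (\<forall>a::'a. \<exists>d. dense_in_upset a d \<and> (\<forall>e. dense_in_upset a e \<longrightarrow> d \<le> e))"


section \<open>The frame of nuclei\<close>

definition is_nucleus :: "('a::frame \<Rightarrow> 'a) \<Rightarrow> bool"
  where "is_nucleus j \<longleftrightarrow>
    (\<forall>a. a \<le> j a) \<and> (\<forall>a. j (j a) \<le> j a) \<and> (\<forall>a b. j (inf a b) = inf (j a) (j b))"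

lemma is_nucleus_mono:
  assumes "is_nucleus j" and "a \<le> b"
  shows "j a \<le> j b"
  using assms by (metis inf.absorb_iff1 is_nucleus_def)

typedef (overloaded) 'a nucleus = "{j :: 'a::frame \<Rightarrow> 'a. is_nucleus j}"
  morphisms apply_nucleus Nucleus
  by (rule exI[of _ id]) (simp add: is_nucleus_def)

setup_lifting type_definition_nucleus

lemma is_nucleus_INF:
  assumes "\<And>j. j \<in> J \<Longrightarrow> is_nucleus j"
  shows "is_nucleus (\<lambda>a. INF j\<in>J. j a)"
  unfolding is_nucleus_def
proof (intro conjI allI)
  fix a b
  show "a \<le> (INF j\<in>J. j a)"
  proof (rule INF_greatest)
    fix j assume "j \<in> J"
    from assms[OF this] show "a \<le> j a"
      by (simp add: is_nucleus_def)
  qed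
  show "(INF j\<in>J. j (INF j\<in>J. j a)) \<le> (INF j\<in>J. j a)"
  proof (rule INF_mono)
    fix j assume j: "j \<in> J"
    have "j (INF j\<in>J. j a) \<le> j (j a)"
      by (rule is_nucleus_mono[OF assms[OF j]], rule INF_lower[OF j])
    also have "\<dots> \<le> j a"
      using assms[OF j] by (simp add: is_nucleus_def)
    finally show "\<exists>i\<in>J. i (INF j\<in>J. j a) \<le> j a"
      using j by blast
  qed
  have "(INF j\<in>J. j (inf a b)) = (INF j\<in>J. inf (j a) (j b))"
  proof (rule INF_cong)
    fix j assume "j \<in> J"
    from assms[OF this] show "j (inf a b) = inf (j a) (j b)"
      by (simp add: is_nucleus_def)
  qed simp
  then show "(INF j\<in>J. j (inf a b)) = inf (INF j\<in>J. j a) (INF j\<in>J. j b)"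
    by (simp add: INF_inf_distrib)
qed

instantiation nucleus :: (frame) complete_lattice
begin

lift_definition less_eq_nucleus :: "'a nucleus \<Rightarrow> 'a nucleus \<Rightarrow> bool"
  is "\<lambda>j k. \<forall>a. j a \<le> k a" .

definition less_nucleus :: "'a nucleus \<Rightarrow> 'a nucleus \<Rightarrow> bool"
  where "less_nucleus j k \<longleftrightarrow> j \<le> k \<and> \<not> k \<le> j"

lift_definition Inf_nucleus :: "'a nucleus set \<Rightarrow> 'a nucleus"
  is "\<lambda>J a. INF j\<in>J. j a"
  by (rule is_nucleus_INF)

text \<open>Joins of nuclei are not pointwise.\<close>

definition Sup_nucleus :: "'a nucleus set \<Rightarrow> 'a nucleus"
  where "Sup_nucleus J = Inf {k. \<forall>j\<in>J. j \<le> k}"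

definition inf_nucleus :: "'a nucleus \<Rightarrow> 'a nucleus \<Rightarrow> 'a nucleus"
  where "inf_nucleus j k = Inf {j, k}"

definition sup_nucleus :: "'a nucleus \<Rightarrow> 'a nucleus \<Rightarrow> 'a nucleus"
  where "sup_nucleus j k = Sup {j, k}"

definition top_nucleus :: "'a nucleus"
  where "top_nucleus = Inf {}"

definition bot_nucleus :: "'a nucleus"
  where "bot_nucleus = Sup {}"

instance
proof -
  have refl: "j \<le> j" for j :: "'a nucleus"
    by transfer simp
  have trans: "j \<le> l" if "j \<le> k" "k \<le> l" for j k l :: "'a nucleus"
    using that by transfer (meson order_trans)
  have antisym: "j = k" if "j \<le> k" "k \<le> j" for j k :: "'a nucleus"
    using that by transfer (simp add: fun_eq_iff order_antisym)
  have lower: "Inf J \<le> j" if "j \<in> J" for j :: "'a nucleus" and J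
    using that by transfer (auto intro: INF_lower)
  have greatest: "l \<le> Inf J" if "\<And>j. j \<in> J \<Longrightarrow> l \<le> j" for l :: "'a nucleus" and J
  proof -
    have "\<forall>j\<in>J. l \<le> j" using that by blast
    then show ?thesis by transfer (auto intro: INF_greatest)
  qed
  have upper: "j \<le> Sup J" if "j \<in> J" for j :: "'a nucleus" and J
    using that by (auto simp: Sup_nucleus_def intro: greatest)
  have least: "Sup J \<le> l" if "\<And>j. j \<in> J \<Longrightarrow> j \<le> l" for l :: "'a nucleus" and J
    using that by (auto simp: Sup_nucleus_def intro: lower)
  show "OFCLASS('a nucleus, complete_lattice_class)"
  proof
    fix j k l :: "'a nucleus" and J
    show "j < k \<longleftrightarrow> j \<le> k \<and> \<not> k \<le> j" by (rule less_nucleus_def)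
    show "j \<le> j" by (rule refl)
    show "j \<le> l" if "j \<le> k" "k \<le> l" using that by (rule trans)
    show "j = k" if "j \<le> k" "k \<le> j" using that by (rule antisym)
    show "inf j k \<le> j" "inf j k \<le> k"
      unfolding inf_nucleus_def by (rule lower, simp)+
    show "j \<le> inf k l" if "j \<le> k" "j \<le> l"
      unfolding inf_nucleus_def using that by (intro greatest) auto
    show "j \<le> sup j k" "k \<le> sup j k"
      unfolding sup_nucleus_def by (rule upper, simp)+
    show "sup k l \<le> j" if "k \<le> j" "l \<le> j"
      unfolding sup_nucleus_def using that by (intro least) auto
    show "Inf J \<le> j" if "j \<in> J" using that by (rule lower)
    show "l \<le> Inf J" if "\<And>j. j \<in> J \<Longrightarrow> l \<le> j" using that by (rule greatest)
    show "j \<le> Sup J" if "j \<in> J" using that by (rule upper)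
    show "Sup J \<le> l" if "\<And>j. j \<in> J \<Longrightarrow> j \<le> l" using that by (rule least)
    show "Inf {} = (top :: 'a nucleus)" "Sup {} = (bot :: 'a nucleus)"
      by (simp_all add: top_nucleus_def bot_nucleus_def)
  qed
qed

end

lemma apply_nucleus_inf: "apply_nucleus (inf j k) a = inf (apply_nucleus j a) (apply_nucleus k a)"
  unfolding inf_nucleus_def by transfer simp

lemma is_nucleus_himp:
  fixes j m :: "'a::frame \<Rightarrow> 'a"
  assumes j: "is_nucleus j" and m: "is_nucleus m"
  shows "is_nucleus (\<lambda>a. INF b\<in>{a..}. himp (j b) (m b))"
proof -
  define n where "n a = (INF b\<in>{a..}. himp (j b) (m b))" for a
  have le_n: "x \<le> n a \<longleftrightarrow> (\<forall>b\<ge>a. inf (j b) x \<le> m b)" for x a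
    by (auto simp: n_def le_INF_iff le_himp_iff)
  have app: "inf (j b) (n a) \<le> m b" if "a \<le> b" for a b
    using le_n[of "n a" a] that by simp
  have mono: "n a \<le> n b" if "a \<le> b" for a b
    unfolding n_def using that by (intro INF_superset_mono) auto
  have infl: "a \<le> n a" for a
    unfolding le_n
  proof (intro allI impI)
    fix b assume "a \<le> b"
    moreover have "b \<le> m b" using m by (simp add: is_nucleus_def)
    ultimately show "inf (j b) a \<le> m b" by (meson inf_le2 order_trans)
  qed
  have idem: "n (n a) \<le> n a" for a
    unfolding le_n
  proof (intro allI impI)
    fix b assume "a \<le> b"
    let ?x = "inf (j b) (n (n a))"
    have "?x \<le> inf (j (n b)) (n (n b))"
      using \<open>a \<le> b\<close> by (intro inf_mono is_nucleus_mono[OF j] infl mono)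
    also have "\<dots> \<le> m (n b)"
      by (rule app) simp
    finally have 1: "?x \<le> m (n b)" .
    have "j b \<le> m (j b)" using m by (simp add: is_nucleus_def)
    then have 2: "?x \<le> m (j b)" by (meson inf_le1 order_trans)
    from 1 2 have "?x \<le> m (inf (j b) (n b))"
      using m by (simp add: is_nucleus_def)
    also have "\<dots> \<le> m (m b)"
      by (intro is_nucleus_mono[OF m] app) simp
    also have "\<dots> \<le> m b"
      using m by (simp add: is_nucleus_def)
    finally show "?x \<le> m b" .
  qed
  have meet: "n (inf a b) = inf (n a) (n b)" for a b
  proof (rule antisym)
    show "n (inf a b) \<le> inf (n a) (n b)"
      by (auto intro: mono)
    show "inf (n a) (n b) \<le> n (inf a b)"
      unfolding le_n
    proof (intro allI impI)
      fix c assume "inf a b \<le> c"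
      let ?x = "inf (j c) (inf (n a) (n b))"
      have "?x \<le> inf (j (sup c a)) (n a)"
        by (intro inf_mono is_nucleus_mono[OF j]) auto
      also have "\<dots> \<le> m (sup c a)" by (rule app) simp
      finally have 1: "?x \<le> m (sup c a)" .
      have "?x \<le> inf (j (sup c b)) (n b)"
        by (intro inf_mono is_nucleus_mono[OF j]) auto
      also have "\<dots> \<le> m (sup c b)" by (rule app) simp
      finally have "?x \<le> m (sup c b)" .
      with 1 have "?x \<le> m (inf (sup c a) (sup c b))"
        using m by (simp add: is_nucleus_def)
      also have "inf (sup c a) (sup c b) = c"
        using \<open>inf a b \<le> c\<close> by (simp add: sup_inf_distrib1[symmetric] sup_absorb1)
      finally show "?x \<le> m c" .
    qed
  qed
  have "is_nucleus n"
    unfolding is_nucleus_def using infl idem meet by blast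
  then show ?thesis
    unfolding n_def[abs_def] .
qed

instance nucleus :: (frame) frame
proof
  fix j :: "'a nucleus" and K
  define m where "m = (SUP k\<in>K. inf j k)"
  let ?n = "\<lambda>a. INF b\<in>{a..}. himp (apply_nucleus j b) (apply_nucleus m b)"
  define n where "n = Nucleus ?n"
  have nuc: "is_nucleus (apply_nucleus k)" for k :: "'a nucleus"
    using apply_nucleus[of k] by simp
  have n: "apply_nucleus n = ?n"
    unfolding n_def by (rule Nucleus_inverse) (simp add: is_nucleus_himp nuc)
  have "Sup K \<le> n"
  proof (rule Sup_least)
    fix k assume "k \<in> K"
    then have "inf j k \<le> m"
      unfolding m_def by (rule SUP_upper)
    then have *: "inf (apply_nucleus j b) (apply_nucleus k b) \<le> apply_nucleus m b" for b
      by (simp add: less_eq_nucleus.rep_eq apply_nucleus_inf)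
    have "inf (apply_nucleus j b) (apply_nucleus k a) \<le> apply_nucleus m b" if "a \<le> b" for a b
      using *[of b] is_nucleus_mono[OF nuc[of k] that] by (meson inf_mono order_refl order_trans)
    then show "k \<le> n"
      by (auto simp: less_eq_nucleus.rep_eq n le_INF_iff le_himp_iff)
  qed
  then have "inf j (Sup K) \<le> inf j n"
    by (rule inf_mono[OF order_refl])
  also have "inf j n \<le> m"
    unfolding less_eq_nucleus.rep_eq apply_nucleus_inf
  proof
    fix a
    have "apply_nucleus n a \<le> himp (apply_nucleus j a) (apply_nucleus m a)"
      unfolding n by (rule INF_lower) simp
    then show "inf (apply_nucleus j a) (apply_nucleus n a) \<le> apply_nucleus m a"
      by (simp add: le_himp_iff)
  qed
  finally have "inf j (Sup K) \<le> m" .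
  moreover have "m \<le> inf j (Sup K)"
    unfolding m_def by (intro SUP_least inf_mono order_refl Sup_upper)
  ultimately show "inf j (Sup K) = (SUP k\<in>K. inf j k)"
    unfolding m_def by (rule antisym)
qed


section \<open>The Esakia space of a frame\<close>

definition prime_filter :: "'a::frame set \<Rightarrow> bool"
  where "prime_filter x \<longleftrightarrow>
    top \<in> x \<and> (\<forall>a\<in>x. \<forall>b\<ge>a. b \<in> x) \<and> (\<forall>a\<in>x. \<forall>b\<in>x. inf a b \<in> x) \<and>
    bot \<notin> x \<and> (\<forall>a b. sup a b \<in> x \<longrightarrow> a \<in> x \<or> b \<in> x)"

definition prime_filters_of :: "'a::frame \<Rightarrow> 'a set set"
  where "prime_filters_of a = {x. prime_filter x \<and> a \<in> x}"

definition esakia_basis :: "'a::frame set set set"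
  where "esakia_basis = {prime_filters_of a - prime_filters_of b | a b. True}"

definition esakia_space :: "'a::frame set topology"
  where "esakia_space = topology (arbitrary union_of (\<lambda>U. U \<in> esakia_basis))"

lemma openin_esakia_space:
  "openin (esakia_space :: 'a::frame set topology) = arbitrary union_of (\<lambda>U. U \<in> esakia_basis)"
proof -
  have Int: "S \<inter> T \<in> esakia_basis"
    if S: "S \<in> esakia_basis" and T: "T \<in> esakia_basis" for S T :: "'a set set"
  proof -
    obtain a b c d where "S = prime_filters_of a - prime_filters_of b"
      and "T = prime_filters_of c - prime_filters_of d"
      using S T by (auto simp: esakia_basis_def)
    moreover have "inf a c \<in> x \<longleftrightarrow> a \<in> x \<and> c \<in> x" if "prime_filter x" for x
      using that unfolding prime_filter_def by (metis inf_le1 inf_le2)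
    moreover have "sup b d \<in> x \<longleftrightarrow> b \<in> x \<or> d \<in> x" if "prime_filter x" for x
      using that unfolding prime_filter_def by (metis sup_ge1 sup_ge2)
    ultimately have "S \<inter> T = prime_filters_of (inf a c) - prime_filters_of (sup b d)"
      by (auto simp: prime_filters_of_def)
    then show ?thesis
      by (auto simp: esakia_basis_def)
  qed
  then have "istopology (arbitrary union_of (\<lambda>U. U \<in> (esakia_basis :: 'a set set set)))"
    by (rule istopology_base)
  then show ?thesis
    unfolding esakia_space_def by (rule topology_inverse')
qed

lemma topspace_esakia_space: "topspace esakia_space = {x :: 'a::frame set. prime_filter x}"
proof
  show "topspace esakia_space \<subseteq> {x :: 'a set. prime_filter x}"
  proof
    fix x :: "'a set" assume "x \<in> topspace esakia_space"
    then obtain U where "openin esakia_space U" and "x \<in> U"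
      using openin_topspace by blast
    then show "x \<in> {x. prime_filter x}"
      by (auto simp: openin_esakia_space union_of_def arbitrary_def esakia_basis_def
          prime_filters_of_def)
  qed
  have "{x :: 'a set. prime_filter x} = prime_filters_of top - prime_filters_of bot"
    by (auto simp: prime_filters_of_def prime_filter_def)
  then have "openin esakia_space {x :: 'a set. prime_filter x}"
    unfolding openin_esakia_space by (intro arbitrary_union_of_inc) (auto simp: esakia_basis_def)
  then show "{x :: 'a set. prime_filter x} \<subseteq> topspace esakia_space"
    by (rule openin_subset)
qed

definition clopenin :: "'b topology \<Rightarrow> 'b set \<Rightarrow> bool"
  where "clopenin X U \<longleftrightarrow> closedin X U \<and> openin X U"

definition regular_closed_sets :: "'b topology \<Rightarrow> 'b set set"
  where "regular_closed_sets X = {F. F \<subseteq> topspace X \<and> F = X closure_of (X interior_of F)}"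

text \<open>The order on the space is inclusion of filters.\<close>

definition downset_of :: "'a::frame set set \<Rightarrow> 'a set set"
  where "downset_of S = {x \<in> topspace esakia_space. \<exists>s\<in>S. x \<subseteq> s}"

definition maximal_points :: "'a set set \<Rightarrow> 'a set set"
  where "maximal_points S = {x \<in> S. \<forall>y\<in>S. x \<subseteq> y \<longrightarrow> y = x}"

definition nuclear_sets :: "'a::frame set set set"
  where "nuclear_sets =
    {F. closedin esakia_space F \<and>
        (\<forall>U. clopenin esakia_space U \<longrightarrow> clopenin esakia_space (downset_of (U \<inter> F)))}"

end

theory Submission
  imports Defs
begin

text \<open>Nuclei correspond to nuclear sets: \<open>j\<close> is sent to the set \<open>F\<close> of its fixed prime filters, and
  \<open>F\<close> is sent to the nucleus for which \<open>j a\<close> belongs to \<open>x\<close> iff \<open>a\<close> belongs to every point of \<open>F\<close>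
  above \<open>x\<close>. This reverses the order and turns binary meets into unions. Regular closed sets are
  always nuclear, because the downset of the closure of an open set is clopen. The complement of \<open>F\<close>
  can only be the closure of the set-theoretic complement, and it exists for all \<open>F\<close> iff no nonempty
  nuclear set is nowhere dense, that is, iff all nuclear sets are regular closed.

  If maximal points of clopen downsets form clopen sets, then every nonempty nuclear set \<open>H\<close> has
  nonempty interior, as \<open>H\<close> contains the maximal points of the clopen set \<open>downset_of H\<close>. Conversely,
  the maximal points of the complement of \<open>prime_filters_of a\<close> form the nuclear set of the
  nucleus \<open>b \<mapsto> (b \<rightarrow> a) \<rightarrow> a\<close>; its interior is relatively an upset, whose closure is clopen. Finally,
  \<open>d \<ge> a\<close> is dense above \<open>a\<close> iff \<open>prime_filters_of d\<close> contains these maximal points, and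
  \<open>b \<squnion> (b \<rightarrow> a)\<close> is always such an element.\<close>

subsection \<open>Prime filter separation\<close>

text \<open>The improper filter is allowed; properness later comes from disjointness from an
  ideal.\<close>

definition lattice_filter :: "'a::frame set \<Rightarrow> bool"
  where "lattice_filter x \<longleftrightarrow>
    top \<in> x \<and> (\<forall>a\<in>x. \<forall>b\<ge>a. b \<in> x) \<and> (\<forall>a\<in>x. \<forall>b\<in>x. inf a b \<in> x)"

definition lattice_ideal :: "'a::frame set \<Rightarrow> bool"
  where "lattice_ideal I \<longleftrightarrow>
    bot \<in> I \<and> (\<forall>a\<in>I. \<forall>b\<le>a. b \<in> I) \<and> (\<forall>a\<in>I. \<forall>b\<in>I. sup a b \<in> I)"

lemma lattice_filterD:
  assumes "lattice_filter x"
  shows "top \<in> x" and "a \<in> x \<Longrightarrow> a \<le> b \<Longrightarrow> b \<in> x" and "a \<in> x \<Longrightarrow> b \<in> x \<Longrightarrow> inf a b \<in> x"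
  using assms by (auto simp: lattice_filter_def)

lemma lattice_idealD:
  assumes "lattice_ideal I"
  shows "bot \<in> I" and "a \<in> I \<Longrightarrow> b \<le> a \<Longrightarrow> b \<in> I" and "a \<in> I \<Longrightarrow> b \<in> I \<Longrightarrow> sup a b \<in> I"
  using assms by (auto simp: lattice_ideal_def)

lemma lattice_ideal_atMost: "lattice_ideal {..b}"
  by (auto simp: lattice_ideal_def intro: order_trans)

text \<open>The displayed set is the filter generated by \<open>x\<close> and
  \<open>c\<close>.\<close>

lemma lattice_filter_adjoin:
  assumes "lattice_filter x"
  shows "lattice_filter {e. \<exists>z\<in>x. inf z c \<le> e}"
  unfolding lattice_filter_def
proof (intro conjI ballI allI impI)
  show "top \<in> {e. \<exists>z\<in>x. inf z c \<le> e}"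
    using lattice_filterD(1)[OF assms] by auto
next
  fix a b
  assume "a \<in> {e. \<exists>z\<in>x. inf z c \<le> e}" and "a \<le> b"
  then show "b \<in> {e. \<exists>z\<in>x. inf z c \<le> e}"
    by (auto intro: order_trans)
next
  fix a b
  assume "a \<in> {e. \<exists>z\<in>x. inf z c \<le> e}" and "b \<in> {e. \<exists>z\<in>x. inf z c \<le> e}"
  then obtain z w where zw: "z \<in> x" "inf z c \<le> a" "w \<in> x" "inf w c \<le> b"
    by auto
  have "inf (inf z w) c \<le> inf z c" and "inf (inf z w) c \<le> inf w c"
    by (simp_all add: inf.coboundedI1)
  then have "inf (inf z w) c \<le> inf a b"
    using zw(2,4) by (simp add: order_trans[OF _ zw(2)] order_trans[OF _ zw(4)])
  then show "inf a b \<in> {e. \<exists>z\<in>x. inf z c \<le> e}"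
    using lattice_filterD(3)[OF assms zw(1,3)] by blast
qed

lemma prime_filterD:
  assumes "prime_filter x"
  shows "top \<in> x" and "a \<in> x \<Longrightarrow> a \<le> b \<Longrightarrow> b \<in> x" and "bot \<notin> x"
    and "inf a b \<in> x \<longleftrightarrow> a \<in> x \<and> b \<in> x" and "sup a b \<in> x \<longleftrightarrow> a \<in> x \<or> b \<in> x"
proof -
  show "top \<in> x" and "bot \<notin> x" and "a \<in> x \<Longrightarrow> a \<le> b \<Longrightarrow> b \<in> x"
    using assms by (auto simp: prime_filter_def)
  show "inf a b \<in> x \<longleftrightarrow> a \<in> x \<and> b \<in> x"
    using assms unfolding prime_filter_def by (metis inf_le1 inf_le2)
  show "sup a b \<in> x \<longleftrightarrow> a \<in> x \<or> b \<in> x"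
    using assms unfolding prime_filter_def by (metis sup_ge1 sup_ge2)
qed

lemmas prime_filter_simps = prime_filterD(1,3-5)

lemma prime_filter_imp_lattice_filter: "prime_filter x \<Longrightarrow> lattice_filter x"
  by (auto simp: prime_filter_def lattice_filter_def)

text \<open>The last conclusion is the maximality of \<open>y\<close> among the filters disjoint from \<open>I\<close>.\<close>

lemma prime_filter_separation:
  assumes x: "lattice_filter x" and I: "lattice_ideal I" and "x \<inter> I = {}"
  obtains y where "prime_filter y" "x \<subseteq> y" "y \<inter> I = {}" "\<forall>c. c \<notin> y \<longrightarrow> (\<exists>z\<in>y. inf z c \<in> I)"
proof -
  let ?A = "{y. lattice_filter y \<and> x \<subseteq> y \<and> y \<inter> I = {}}"
  have "\<exists>y\<in>?A. \<forall>z\<in>?A. y \<subseteq> z \<longrightarrow> z = y"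
  proof (rule subset_Zorn_nonempty)
    show "?A \<noteq> {}" using assms by blast
  next
    fix C assume "C \<noteq> {}" and ch: "subset.chain ?A C"
    then obtain y0 where y0: "y0 \<in> C" by blast
    have C: "lattice_filter y" "x \<subseteq> y" "y \<inter> I = {}" if "y \<in> C" for y
      using ch that by (auto simp: subset.chain_def)
    have "lattice_filter (\<Union>C)"
      unfolding lattice_filter_def
    proof (intro conjI ballI allI impI)
      show "top \<in> \<Union>C" using lattice_filterD(1)[OF C(1)[OF y0]] y0 by (rule UnionI[rotated])
      show "b \<in> \<Union>C" if "a \<in> \<Union>C" "a \<le> b" for a b
        using that lattice_filterD(2)[OF C(1)] by (meson UnionE UnionI)
      show "inf a b \<in> \<Union>C" if ab: "a \<in> \<Union>C" "b \<in> \<Union>C" for a b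
      proof -
        obtain y z where yz: "y \<in> C" "z \<in> C" "a \<in> y" "b \<in> z" using ab by blast
        then have "y \<subseteq> z \<or> z \<subseteq> y" using ch by (meson subset_chain_def)
        then obtain w where "w \<in> C" "a \<in> w" "b \<in> w" using yz by blast
        then show ?thesis using lattice_filterD(3)[OF C(1)] by (meson UnionI)
      qed
    qed
    moreover have "x \<subseteq> \<Union>C" using C(2)[OF y0] y0 by blast
    moreover have "\<Union>C \<inter> I = {}" using C(3) by blast
    ultimately show "\<Union>C \<in> ?A" by simp
  qed
  then obtain y where yA: "y \<in> ?A" and "\<forall>z\<in>?A. y \<subseteq> z \<longrightarrow> z = y"
    by (rule bexE)
  then have max: "z = y" if "lattice_filter z" "x \<subseteq> z" "z \<inter> I = {}" "y \<subseteq> z" for z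
    using that by simp
  from yA have y: "lattice_filter y" "x \<subseteq> y" "y \<inter> I = {}"
    by simp_all
  \<comment> \<open>The filter generated by \<open>y\<close> and \<open>c\<close> is strictly larger
    than \<open>y\<close>, so maximality forces it to meet \<open>I\<close>.\<close>
  have mx: "\<exists>z\<in>y. inf z c \<in> I" if c: "c \<notin> y" for c
  proof (rule ccontr)
    assume no: "\<not> (\<exists>z\<in>y. inf z c \<in> I)"
    let ?z = "{e. \<exists>z\<in>y. inf z c \<le> e}"
    have "y \<subseteq> ?z" using inf_le1 by blast
    moreover have "?z \<inter> I = {}" using no lattice_idealD(2)[OF I] by blast
    ultimately have "?z = y"
      using max[OF lattice_filter_adjoin[OF y(1)]] y(2) by simp
    moreover have "c \<in> ?z" using lattice_filterD(1)[OF y(1)] inf_le2 by blast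
    ultimately show False using c by blast
  qed
  \<comment> \<open>If neither is in \<open>y\<close>, meets with elements of \<open>y\<close> push
    both \<open>c\<close> and \<open>d\<close> into \<open>I\<close>; distributivity then puts an
    element of \<open>y\<close> into \<open>I\<close>.\<close>
  have prime: "c \<in> y \<or> d \<in> y" if cd: "sup c d \<in> y" for c d
  proof (rule ccontr)
    assume "\<not> (c \<in> y \<or> d \<in> y)"
    then obtain z w where zw: "z \<in> y" "inf z c \<in> I" "w \<in> y" "inf w d \<in> I"
      using mx by meson
    have "inf (inf z w) (sup c d) \<le> sup (inf z c) (inf w d)"
      unfolding inf_sup_distrib1 by (intro sup_mono inf_mono) auto
    then have "inf (inf z w) (sup c d) \<in> I"
      using lattice_idealD(2,3)[OF I] zw(2,4) by blast
    then show False using lattice_filterD(3)[OF y(1)] zw(1,3) cd y(3) by blast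
  qed
  have "prime_filter y"
    using y(1,3) lattice_idealD(1)[OF I] prime unfolding prime_filter_def lattice_filter_def
    by (meson disjoint_iff)
  then show ?thesis using that[of y] y(2,3) mx by simp
qed

lemma prime_filter_separation_le:
  assumes "lattice_filter x" and "b \<notin> x"
  obtains y where "prime_filter y" "x \<subseteq> y" "b \<notin> y" "\<forall>c. c \<notin> y \<longrightarrow> (\<exists>z\<in>y. inf z c \<le> b)"
proof -
  have "x \<inter> {..b} = {}" using assms lattice_filterD(2) by blast
  from prime_filter_separation[OF assms(1) lattice_ideal_atMost this] that
  show ?thesis by (metis Int_iff atMost_iff empty_iff order_refl)
qed

lemma prime_filter_himpD:
  assumes "prime_filter x" "himp a b \<in> x" "a \<in> x"
  shows "b \<in> x"
proof -
  have "inf a (himp a b) \<le> b" using le_himp_iff by blast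
  then show ?thesis using assms prime_filterD(2,4)[OF assms(1)] by blast
qed

text \<open>If the filter generated by \<open>x\<close> and \<open>c\<close> contained
  \<open>b\<close>, some \<open>z \<in> x\<close> would satisfy \<open>inf z c \<le> b\<close>, that
  is, \<open>z \<le> himp c b\<close>.\<close>

lemma prime_filter_himp_separation:
  assumes "prime_filter x" "himp c b \<notin> x"
  obtains y where "prime_filter y" "x \<subseteq> y" "c \<in> y" "b \<notin> y"
proof -
  let ?z = "{e. \<exists>z\<in>x. inf z c \<le> e}"
  have f: "lattice_filter x" using assms prime_filter_imp_lattice_filter by blast
  have "b \<notin> ?z"
  proof
    assume "b \<in> ?z"
    then obtain z where "z \<in> x" "inf z c \<le> b" by blast
    moreover from this have "z \<le> himp c b" by (simp add: le_himp_iff inf_commute)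
    ultimately show False using assms(2) lattice_filterD(2)[OF f] by blast
  qed
  with lattice_filter_adjoin[OF f] obtain y where y: "prime_filter y" "?z \<subseteq> y" "b \<notin> y"
    by (rule prime_filter_separation_le)
  have "x \<subseteq> ?z" using inf_le1 by blast
  moreover have "c \<in> ?z" using lattice_filterD(1)[OF f] inf_le2 by blast
  ultimately show ?thesis using that[of y] y by (meson subset_iff)
qed

lemma prime_filters_of_subset_iff: "prime_filters_of a \<subseteq> prime_filters_of b \<longleftrightarrow> a \<le> b"
proof
  assume sub: "prime_filters_of a \<subseteq> prime_filters_of b"
  show "a \<le> b"
  proof (rule ccontr)
    assume "\<not> a \<le> b"
    moreover have "lattice_filter {a..}" by (auto simp: lattice_filter_def intro: order_trans)
    ultimately obtain y where "prime_filter y" "{a..} \<subseteq> y" "b \<notin> y"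
      using prime_filter_separation_le[of "{a..}" b] unfolding atLeast_iff by metis
    then show False using sub by (auto simp: prime_filters_of_def)
  qed
qed (auto simp: prime_filters_of_def intro: prime_filterD(2))

text \<open>Reduces inequalities in the frame to membership in prime filters; it rests on separating
  the principal filter of \<open>a\<close> from \<open>b\<close>.\<close>

lemma le_prime_filterI:
  assumes "\<And>x. prime_filter x \<Longrightarrow> a \<in> x \<Longrightarrow> b \<in> x"
  shows "a \<le> b"
  using assms prime_filters_of_subset_iff[of a b] by (auto simp: prime_filters_of_def)

subsection \<open>Clopen sets of the Esakia space\<close>

text \<open>Makes prime filters of sets of points available; they serve as ultrafilters in the
  compactness proof.\<close>

instance set :: (type) frame
  by standard auto

lemma prime_filters_of_top: "prime_filters_of top = topspace esakia_space"
  by (auto simp: prime_filters_of_def topspace_esakia_space prime_filter_simps)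

lemma prime_filters_of_bot: "prime_filters_of bot = {}"
  by (auto simp: prime_filters_of_def prime_filter_simps)

lemma prime_filters_of_inf: "prime_filters_of (inf a b) = prime_filters_of a \<inter> prime_filters_of b"
  by (auto simp: prime_filters_of_def prime_filter_simps)

lemma prime_filters_of_sup: "prime_filters_of (sup a b) = prime_filters_of a \<union> prime_filters_of b"
  by (auto simp: prime_filters_of_def prime_filter_simps)

lemma openin_esakia_space_basic: "openin esakia_space (prime_filters_of a - prime_filters_of b)"
  unfolding openin_esakia_space by (intro arbitrary_union_of_inc) (auto simp: esakia_basis_def)

lemma openin_esakia_spaceD:
  assumes "openin esakia_space U" and "x \<in> U"
  obtains a b where "x \<in> prime_filters_of a - prime_filters_of b"
    and "prime_filters_of a - prime_filters_of b \<subseteq> U"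
proof -
  obtain \<U> where "\<U> \<subseteq> esakia_basis" "\<Union>\<U> = U"
    using assms(1) by (auto simp: openin_esakia_space union_of_def arbitrary_def)
  then show ?thesis
    using assms(2) that unfolding esakia_basis_def by blast
qed

lemma clopenin_prime_filters_of: "clopenin esakia_space (prime_filters_of a)"
proof -
  have "topspace esakia_space - prime_filters_of a = prime_filters_of top - prime_filters_of a"
    and "prime_filters_of a = prime_filters_of a - prime_filters_of bot"
    by (auto simp: topspace_esakia_space prime_filters_of_def prime_filter_simps)
  then have "openin esakia_space (topspace esakia_space - prime_filters_of a)"
    and "openin esakia_space (prime_filters_of a)"
    by (metis openin_esakia_space_basic)+
  then show ?thesis
    by (simp add: clopenin_def closedin_def openin_subset)
qed

lemma clopenin_complement: "clopenin X U \<Longrightarrow> clopenin X (topspace X - U)"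
  by (simp add: clopenin_def closedin_diff openin_diff)

lemma clopenin_Diff: "clopenin X U \<Longrightarrow> clopenin X V \<Longrightarrow> clopenin X (U - V)"
  by (simp add: clopenin_def closedin_diff openin_diff)

lemma clopenin_Int: "clopenin X U \<Longrightarrow> clopenin X V \<Longrightarrow> clopenin X (U \<inter> V)"
  by (simp add: clopenin_def closedin_Int openin_Int)

text \<open>A cover without finite subcover is avoided by an ultrafilter, obtained as a prime filter of
  the frame of all sets of points. An ultrafilter converges to the prime filter of all \<open>a\<close> for
  which it contains \<open>prime_filters_of a\<close>.\<close>

lemma esakia_basic_compact:
  assumes cover: "topspace esakia_space \<subseteq> \<Union>\<C>" and basic: "\<C> \<subseteq> esakia_basis"
  obtains (subcover) \<F> where "finite \<F>" "\<F> \<subseteq> \<C>" "topspace esakia_space \<subseteq> \<Union>\<F>"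
proof (rule ccontr)
  assume "\<not> thesis"
  then have no: "\<not> topspace esakia_space \<subseteq> \<Union>\<F>" if "finite \<F>" "\<F> \<subseteq> \<C>" for \<F>
    using subcover[OF that] by (rule contrapos_nn)
  let ?X = "topspace (esakia_space :: 'a set topology)"
  let ?I = "{S. \<exists>\<F>. finite \<F> \<and> \<F> \<subseteq> \<C> \<and> S \<subseteq> \<Union>\<F>}"
  have ideal: "lattice_ideal ?I"
    unfolding lattice_ideal_def
  proof (intro conjI ballI allI impI)
    show "bot \<in> ?I" by (auto intro: exI[of _ "{}"])
    show "T \<in> ?I" if "S \<in> ?I" "T \<le> S" for S T
      using that unfolding mem_Collect_eq by (meson order_trans)
    show "sup S T \<in> ?I" if ST: "S \<in> ?I" "T \<in> ?I" for S T
    proof -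
      obtain \<F> \<G> where "finite \<F>" "\<F> \<subseteq> \<C>" "S \<subseteq> \<Union>\<F>" "finite \<G>" "\<G> \<subseteq> \<C>" "T \<subseteq> \<Union>\<G>"
        using ST unfolding mem_Collect_eq by metis
      then have "finite (\<F> \<union> \<G>) \<and> \<F> \<union> \<G> \<subseteq> \<C> \<and> sup S T \<subseteq> \<Union>(\<F> \<union> \<G>)" by auto
      then show ?thesis unfolding mem_Collect_eq by (rule exI)
    qed
  qed
  \<comment> \<open>Elements of this frame may have members that are not prime filters, so the
    filter starts at \<open>?X\<close> instead of \<open>top\<close>; this yields
    \<open>?X \<in> u\<close> and hence \<open>top \<in> x\<close>.\<close>
  have filter: "lattice_filter {?X..}"
    by (auto simp: lattice_filter_def)
  have disj: "{?X..} \<inter> ?I = {}"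
  proof -
    have False if S: "?X \<subseteq> S" "S \<in> ?I" for S
    proof -
      from S(2) obtain \<F> where F: "finite \<F>" "\<F> \<subseteq> \<C>" "S \<subseteq> \<Union>\<F>"
        unfolding mem_Collect_eq by metis
      from S(1) F(3) have "?X \<subseteq> \<Union>\<F>" by (rule subset_trans)
      with no[OF F(1,2)] show False ..
    qed
    then show ?thesis by (intro equals0I, elim IntE) (simp only: atLeast_iff)
  qed
  obtain u where u: "prime_filter u" "{?X..} \<subseteq> u" "u \<inter> ?I = {}"
    by (rule prime_filter_separation[OF filter ideal disj])
  define x where "x = {a. prime_filters_of a \<in> u}"
  have x: "prime_filter x"
    unfolding prime_filter_def
  proof (intro conjI ballI allI impI)
    show "top \<in> x"
      using subsetD[OF u(2), of ?X] by (simp add: x_def prime_filters_of_top)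
    show "bot \<notin> x"
      using prime_filterD(3)[OF u(1)] by (simp add: x_def prime_filters_of_bot)
    show "b \<in> x" if "a \<in> x" "a \<le> b" for a b
      using that prime_filterD(2)[OF u(1)] prime_filters_of_subset_iff[of a b] by (simp add: x_def)
    show "inf a b \<in> x" if "a \<in> x" "b \<in> x" for a b
      using that prime_filterD(4)[OF u(1)] by (simp add: x_def prime_filters_of_inf)
    show "a \<in> x \<or> b \<in> x" if "sup a b \<in> x" for a b
      using that prime_filterD(5)[OF u(1)] by (simp add: x_def prime_filters_of_sup)
  qed
  then have "x \<in> \<Union>\<C>"
    using cover by (auto simp: topspace_esakia_space)
  then obtain S where S: "S \<in> \<C>" "x \<in> S" by blast
  then obtain a b where "S = prime_filters_of a - prime_filters_of b"
    using basic unfolding esakia_basis_def by blast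
  with S x have ab: "prime_filters_of a - prime_filters_of b \<in> \<C>" "a \<in> x" "b \<notin> x"
    by (auto simp: prime_filters_of_def)
  \<comment> \<open>By primality \<open>u\<close> contains the basic set or
    \<open>prime_filters_of b\<close>. The latter is excluded by \<open>b \<notin> x\<close>, and
    the former lies in the ideal, being a member of the cover.\<close>
  have "prime_filters_of a \<subseteq> sup (prime_filters_of a - prime_filters_of b) (prime_filters_of b)"
    by auto
  with ab(2) have "sup (prime_filters_of a - prime_filters_of b) (prime_filters_of b) \<in> u"
    unfolding x_def mem_Collect_eq by (rule prime_filterD(2)[OF u(1)])
  then have "prime_filters_of a - prime_filters_of b \<in> u"
    using ab(3) unfolding prime_filterD(5)[OF u(1)] x_def by simp
  moreover have "prime_filters_of a - prime_filters_of b \<in> ?I"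
    unfolding mem_Collect_eq
    by (rule exI[of _ "{prime_filters_of a - prime_filters_of b}"]) (simp add: ab(1))
  ultimately show False using u(3) by blast
qed

text \<open>The basic sets inside \<open>U\<close> or inside its complement cover the space.
  Compactness leaves finitely many, and those inside \<open>U\<close> exhaust
  \<open>U\<close>.\<close>

lemma clopenin_esakia_space_finite:
  assumes "clopenin esakia_space U"
  obtains \<F> where "finite \<F>" "\<F> \<subseteq> esakia_basis" "U = \<Union>\<F>"
proof -
  let ?V = "topspace esakia_space - U"
  let ?C = "{S \<in> esakia_basis. S \<subseteq> U \<or> S \<subseteq> ?V}"
  have op: "openin esakia_space U" "openin esakia_space ?V"
    using assms by (auto simp: clopenin_def)
  have "topspace esakia_space \<subseteq> \<Union>?C"
  proof
    fix x :: "'a set" assume "x \<in> topspace esakia_space"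
    then have "x \<in> U \<or> x \<in> ?V" by blast
    then obtain a b where "x \<in> prime_filters_of a - prime_filters_of b"
      "prime_filters_of a - prime_filters_of b \<subseteq> U \<or> prime_filters_of a - prime_filters_of b \<subseteq> ?V"
      using openin_esakia_spaceD[OF op(1), of x] openin_esakia_spaceD[OF op(2), of x] by metis
    then show "x \<in> \<Union>?C" unfolding esakia_basis_def by blast
  qed
  moreover have "?C \<subseteq> esakia_basis" by blast
  ultimately obtain \<F> where F: "finite \<F>" "\<F> \<subseteq> ?C" "topspace esakia_space \<subseteq> \<Union>\<F>"
    by (rule esakia_basic_compact)
  let ?G = "{S \<in> \<F>. S \<subseteq> U}"
  have "U \<subseteq> topspace esakia_space" using op(1) openin_subset by blast
  have "U = \<Union>?G"
  proof
    show "U \<subseteq> \<Union>?G"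
    proof
      fix x assume "x \<in> U"
      moreover from this obtain S where "S \<in> \<F>" "x \<in> S"
        using F(3) \<open>U \<subseteq> topspace esakia_space\<close> by (meson UnionE subsetD)
      ultimately show "x \<in> \<Union>?G" using F(2) by auto
    qed
  qed auto
  moreover have "finite ?G" "?G \<subseteq> esakia_basis" using F by auto
  ultimately show ?thesis using that by blast
qed

lemma downset_of_basic:
  "downset_of (prime_filters_of p - prime_filters_of q)
    = topspace esakia_space - prime_filters_of (himp p q)"
proof (intro equalityI subsetI)
  fix x assume "x \<in> downset_of (prime_filters_of p - prime_filters_of q)"
  then obtain y where "x \<in> topspace esakia_space" "prime_filter y" "p \<in> y" "q \<notin> y" "x \<subseteq> y"
    by (auto simp: downset_of_def prime_filters_of_def)
  then show "x \<in> topspace esakia_space - prime_filters_of (himp p q)"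
    using prime_filter_himpD[of y p q] by (auto simp: prime_filters_of_def)
next
  fix x assume "x \<in> topspace esakia_space - prime_filters_of (himp p q)"
  then have x: "prime_filter x" "himp p q \<notin> x"
    by (auto simp: topspace_esakia_space prime_filters_of_def)
  then obtain y where "prime_filter y" "x \<subseteq> y" "p \<in> y" "q \<notin> y"
    by (rule prime_filter_himp_separation)
  then show "x \<in> downset_of (prime_filters_of p - prime_filters_of q)"
    using x(1) by (auto simp: downset_of_def prime_filters_of_def topspace_esakia_space)
qed

text \<open>Downsets commute with the finite union of basic sets making up \<open>D\<close>, and
  each basic set contributes the complement of the set of an implication. The union of these
  complements belongs to the meet of the implications.\<close>

lemma clopenin_downset:
  assumes "clopenin esakia_space D" and "D = downset_of D"
  obtains a where "D = topspace esakia_space - prime_filters_of a"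
proof -
  obtain \<F> where F: "finite \<F>" "\<F> \<subseteq> esakia_basis" "D = \<Union>\<F>"
    using clopenin_esakia_space_finite[OF assms(1)] .
  have "\<exists>a. downset_of (\<Union>\<F>) = topspace esakia_space - prime_filters_of a"
    using F(1,2)
  proof (induction \<F>)
    case empty
    then show ?case
      by (auto simp: downset_of_def topspace_esakia_space prime_filters_of_def prime_filter_def
          intro!: exI[of _ top])
  next
    case (insert S \<F>)
    then obtain a p q where a: "downset_of (\<Union>\<F>) = topspace esakia_space - prime_filters_of a"
      and S: "S = prime_filters_of p - prime_filters_of q"
      by (auto simp: esakia_basis_def)
    have "downset_of S = topspace esakia_space - prime_filters_of (himp p q)"
      unfolding S by (rule downset_of_basic)
    moreover have "downset_of (\<Union>(insert S \<F>)) = downset_of S \<union> downset_of (\<Union>\<F>)"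
      by (auto simp: downset_of_def)
    ultimately have "downset_of (\<Union>(insert S \<F>))
        = topspace esakia_space - prime_filters_of (inf (himp p q) a)"
      using a by (simp add: prime_filters_of_inf Diff_Int)
    then show ?case by (rule exI)
  qed
  then show ?thesis using that assms(2) F(3) by metis
qed

subsection \<open>Nuclei and nuclear sets\<close>

lemma subset_downset_of: "S \<subseteq> topspace esakia_space \<Longrightarrow> S \<subseteq> downset_of S"
  by (auto simp: downset_of_def)

lemma downset_of_idem: "downset_of (downset_of S) = downset_of S"
  by (auto simp: downset_of_def intro: order_trans)

text \<open>A clopen set is a finite union of basic sets, and \<open>downset_of\<close> distributes
  over it, so testing basic sets is enough.\<close>

lemma nuclear_setsI:
  assumes "closedin esakia_space F"
    and "\<And>p q. clopenin esakia_space (downset_of ((prime_filters_of p - prime_filters_of q) \<inter> F))"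
  shows "F \<in> nuclear_sets"
  unfolding nuclear_sets_def
proof (intro CollectI conjI allI impI)
  fix U :: "'a set set" assume "clopenin esakia_space U"
  then obtain \<F> where F: "finite \<F>" "\<F> \<subseteq> esakia_basis" "U = \<Union>\<F>"
    by (rule clopenin_esakia_space_finite)
  have eq: "downset_of (U \<inter> F) = (\<Union>S\<in>\<F>. downset_of (S \<inter> F))"
    unfolding F(3) by (auto simp: downset_of_def)
  have "clopenin esakia_space (downset_of (S \<inter> F))" if "S \<in> \<F>" for S
  proof -
    from that F(2) obtain p q where "S = prime_filters_of p - prime_filters_of q"
      unfolding esakia_basis_def by blast
    then show ?thesis using assms(2) by simp
  qed
  then show "clopenin esakia_space (downset_of (U \<inter> F))"
    unfolding eq clopenin_def using F(1) by (auto intro: closedin_Union openin_Union)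
qed (rule assms(1))

lemma nuclear_setsD:
  assumes "F \<in> nuclear_sets"
  shows "closedin esakia_space F" and "F \<subseteq> topspace esakia_space"
    and "clopenin esakia_space U \<Longrightarrow> clopenin esakia_space (downset_of (U \<inter> F))"
  using assms closedin_subset unfolding nuclear_sets_def by blast+

text \<open>Allows localising a nuclear set to a basic neighbourhood of one of its points.\<close>

lemma nuclear_Int_clopen:
  assumes F: "F \<in> nuclear_sets" and V: "clopenin esakia_space V"
  shows "V \<inter> F \<in> nuclear_sets"
proof (rule nuclear_setsI)
  show "closedin esakia_space (V \<inter> F)"
    using nuclear_setsD(1)[OF F] V by (simp add: clopenin_def closedin_Int)
  fix p q
  have "clopenin esakia_space ((prime_filters_of p - prime_filters_of q) \<inter> V)"
    by (intro clopenin_Int clopenin_Diff clopenin_prime_filters_of V)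
  from nuclear_setsD(3)[OF F this]
  show "clopenin esakia_space (downset_of ((prime_filters_of p - prime_filters_of q) \<inter> (V \<inter> F)))"
    unfolding Int_assoc .
qed

section \<open>The correspondence between nuclei and nuclear sets\<close>

text \<open>As \<open>a \<le> j a\<close> for a nucleus, these are the prime filters that equal
  their own preimage under \<open>j\<close>.\<close>

definition nucleus_set :: "('a::frame \<Rightarrow> 'a) \<Rightarrow> 'a set set"
  where "nucleus_set j = {x. prime_filter x \<and> (\<forall>a. j a \<in> x \<longrightarrow> a \<in> x)}"

lemma is_nucleusD:
  assumes "is_nucleus j"
  shows "a \<le> j a" and "j (j a) \<le> j a" and "j (inf a b) = inf (j a) (j b)"
  using assms by (simp_all add: is_nucleus_def)

text \<open>A filter \<open>y\<close> above \<open>x\<close> and maximal among those omitting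
  \<open>j b\<close> is fixed: if \<open>c \<notin> y\<close>, some \<open>z \<in> y\<close> has
  \<open>inf z c \<le> j b\<close>, and applying \<open>j\<close> gives
  \<open>inf z (j c) \<le> j b\<close>, so \<open>j c \<notin> y\<close>.\<close>

lemma nucleus_set_separation:
  assumes j: "is_nucleus j" and x: "prime_filter x" "j b \<notin> x"
  obtains y where "y \<in> nucleus_set j" "x \<subseteq> y" "b \<notin> y"
proof -
  obtain y where y: "prime_filter y" "x \<subseteq> y" "j b \<notin> y"
    and max: "\<forall>c. c \<notin> y \<longrightarrow> (\<exists>z\<in>y. inf z c \<le> j b)"
    by (rule prime_filter_separation_le[OF prime_filter_imp_lattice_filter[OF x(1)] x(2)])
  have "c \<in> y" if c: "j c \<in> y" for c
  proof (rule ccontr)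
    assume "c \<notin> y"
    then obtain z where z: "z \<in> y" "inf z c \<le> j b" using max by metis
    have "inf z (j c) \<le> inf (j z) (j c)"
      by (intro inf_mono order_refl is_nucleusD(1)[OF j])
    also have "\<dots> = j (inf z c)" by (simp add: is_nucleusD(3)[OF j])
    also have "\<dots> \<le> j (j b)" by (rule is_nucleus_mono[OF j z(2)])
    also have "\<dots> \<le> j b" by (rule is_nucleusD(2)[OF j])
    finally have "inf z (j c) \<le> j b" .
    moreover have "inf z (j c) \<in> y" using z(1) c by (simp add: prime_filterD(4)[OF y(1)])
    ultimately show False using y(3) prime_filterD(2)[OF y(1)] by metis
  qed
  then have "y \<in> nucleus_set j" using y(1) by (simp add: nucleus_set_def)
  moreover have "b \<notin> y" using y(3) prime_filterD(2)[OF y(1) _ is_nucleusD(1)[OF j]] by metis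
  ultimately show ?thesis using that y(2) by metis
qed

text \<open>A fixed prime filter omits \<open>q\<close> iff it omits \<open>j q\<close>. From a
  point omitting the implication one first climbs to a point with \<open>p\<close> but without
  \<open>j q\<close>, then to a fixed one without \<open>q\<close>.\<close>

lemma downset_of_nucleus_set:
  assumes j: "is_nucleus j"
  shows "downset_of ((prime_filters_of p - prime_filters_of q) \<inter> nucleus_set j)
    = topspace esakia_space - prime_filters_of (himp p (j q))"
proof (intro equalityI subsetI)
  fix x assume "x \<in> downset_of ((prime_filters_of p - prime_filters_of q) \<inter> nucleus_set j)"
  then obtain y where y: "prime_filter x" "prime_filter y" "x \<subseteq> y" "p \<in> y" "j q \<notin> y"
    by (auto simp: downset_of_def prime_filters_of_def nucleus_set_def topspace_esakia_space)
  then have "himp p (j q) \<notin> x"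
    using prime_filter_himpD[OF y(2)] by (meson subsetD)
  then show "x \<in> topspace esakia_space - prime_filters_of (himp p (j q))"
    using y(1) by (simp add: prime_filters_of_def topspace_esakia_space)
next
  fix x assume "x \<in> topspace esakia_space - prime_filters_of (himp p (j q))"
  then have x: "prime_filter x" "himp p (j q) \<notin> x"
    by (auto simp: topspace_esakia_space prime_filters_of_def)
  then obtain z where z: "prime_filter z" "x \<subseteq> z" "p \<in> z" "j q \<notin> z"
    by (rule prime_filter_himp_separation)
  obtain y where y: "y \<in> nucleus_set j" "z \<subseteq> y" "q \<notin> y"
    using nucleus_set_separation[OF j z(1,4)] .
  have "prime_filter y" "p \<in> y" "x \<subseteq> y" using y(1,2) z(2,3) by (auto simp: nucleus_set_def)
  then show "x \<in> downset_of ((prime_filters_of p - prime_filters_of q) \<inter> nucleus_set j)"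
    using x(1) y(1,3) unfolding downset_of_def prime_filters_of_def topspace_esakia_space
    by simp (rule bexI[of _ y]; simp)
qed

lemma closedin_nucleus_set: "closedin esakia_space (nucleus_set j)"
proof -
  have "topspace esakia_space - nucleus_set j
      = (\<Union>a. prime_filters_of (j a) - prime_filters_of a)"
    by (auto simp: nucleus_set_def topspace_esakia_space prime_filters_of_def)
  moreover have "openin esakia_space (\<Union>a. prime_filters_of (j a) - prime_filters_of a)"
    by (rule openin_Union) (auto intro: openin_esakia_space_basic)
  ultimately show ?thesis
    by (auto simp: closedin_def nucleus_set_def topspace_esakia_space)
qed

lemma nuclear_nucleus_set:
  assumes "is_nucleus j"
  shows "nucleus_set j \<in> nuclear_sets"
  using closedin_nucleus_set
  by (rule nuclear_setsI) (simp add: downset_of_nucleus_set[OF assms] clopenin_prime_filters_of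
      clopenin_complement)

text \<open>For nuclear \<open>F\<close> the set on the left is a clopen downset, so such a
  \<open>b\<close> exists; it is unique since \<open>prime_filters_of\<close> is injective.\<close>

definition nuclear_nucleus :: "'a::frame set set \<Rightarrow> 'a \<Rightarrow> 'a"
  where "nuclear_nucleus F a =
    (SOME b. downset_of (F - prime_filters_of a) = topspace esakia_space - prime_filters_of b)"

text \<open>The only access to the choice in \<open>nuclear_nucleus\<close>; all later facts argue
  with points of \<open>F\<close> above \<open>x\<close>.\<close>

lemma nuclear_nucleus_mem_iff:
  assumes F: "F \<in> nuclear_sets" and x: "prime_filter x"
  shows "nuclear_nucleus F a \<in> x \<longleftrightarrow> (\<forall>y\<in>F. x \<subseteq> y \<longrightarrow> a \<in> y)"
proof -
  have "F - prime_filters_of a = (topspace esakia_space - prime_filters_of a) \<inter> F"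
    using nuclear_setsD(2)[OF F] by blast
  moreover have "clopenin esakia_space (topspace esakia_space - prime_filters_of a)"
    by (intro clopenin_complement clopenin_prime_filters_of)
  ultimately have "clopenin esakia_space (downset_of (F - prime_filters_of a))"
    using nuclear_setsD(3)[OF F] by simp
  then obtain b where "downset_of (F - prime_filters_of a) = topspace esakia_space - prime_filters_of b"
    by (rule clopenin_downset) (simp add: downset_of_idem)
  then have "downset_of (F - prime_filters_of a)
      = topspace esakia_space - prime_filters_of (nuclear_nucleus F a)"
    unfolding nuclear_nucleus_def by (rule someI)
  then have "x \<in> downset_of (F - prime_filters_of a) \<longleftrightarrow> nuclear_nucleus F a \<notin> x"
    using x by (simp add: topspace_esakia_space prime_filters_of_def)
  then have "nuclear_nucleus F a \<notin> x \<longleftrightarrow> (\<exists>y\<in>F - prime_filters_of a. x \<subseteq> y)"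
    using x by (simp add: downset_of_def topspace_esakia_space)
  also have "\<dots> \<longleftrightarrow> (\<exists>y\<in>F. x \<subseteq> y \<and> a \<notin> y)"
    using nuclear_setsD(2)[OF F] by (auto simp: prime_filters_of_def topspace_esakia_space)
  finally show ?thesis by metis
qed

lemma is_nucleus_nuclear_nucleus:
  assumes F: "F \<in> nuclear_sets"
  shows "is_nucleus (nuclear_nucleus F)"
  unfolding is_nucleus_def
proof (intro conjI allI)
  have prime: "prime_filter y" if "y \<in> F" for y
    using that nuclear_setsD(2)[OF F] by (auto simp: topspace_esakia_space)
  fix a b
  show "a \<le> nuclear_nucleus F a"
    by (rule le_prime_filterI) (auto simp: nuclear_nucleus_mem_iff[OF F])
  show "nuclear_nucleus F (nuclear_nucleus F a) \<le> nuclear_nucleus F a"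
  proof (rule le_prime_filterI)
    fix x assume x: "prime_filter x" "nuclear_nucleus F (nuclear_nucleus F a) \<in> x"
    \<comment> \<open>A point \<open>y\<close> of \<open>F\<close> is itself among the points of
      \<open>F\<close> above \<open>y\<close>, so the description can be applied a second time at
      \<open>y\<close>.\<close>
    have "a \<in> y" if y: "y \<in> F" "x \<subseteq> y" for y
    proof -
      have "nuclear_nucleus F a \<in> y"
        using x y by (simp add: nuclear_nucleus_mem_iff[OF F])
      then show ?thesis using y(1) by (simp add: nuclear_nucleus_mem_iff[OF F prime[OF y(1)]])
    qed
    then show "nuclear_nucleus F a \<in> x"
      using x(1) by (simp add: nuclear_nucleus_mem_iff[OF F])
  qed
  have "nuclear_nucleus F (inf a b) \<in> x \<longleftrightarrow> inf (nuclear_nucleus F a) (nuclear_nucleus F b) \<in> x"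
    if x: "prime_filter x" for x
    using prime
    by (auto simp: nuclear_nucleus_mem_iff[OF F x] prime_filterD(4)[OF x] prime_filterD(4)[OF prime])
  then show "nuclear_nucleus F (inf a b) = inf (nuclear_nucleus F a) (nuclear_nucleus F b)"
    by (intro antisym le_prime_filterI) simp_all
qed

text \<open>Here closedness of \<open>F\<close> enters: a fixed \<open>x\<close> outside
  \<open>F\<close> has a basic neighbourhood missing \<open>F\<close>. Points of \<open>F\<close>
  above \<open>x\<close> contain \<open>p\<close>, hence also \<open>q\<close>, so the nucleus puts
  \<open>q\<close> into \<open>x\<close>.\<close>

lemma nucleus_set_nuclear_nucleus:
  assumes F: "F \<in> nuclear_sets"
  shows "nucleus_set (nuclear_nucleus F) = F"
proof (intro equalityI subsetI)
  fix x assume "x \<in> F"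
  moreover from this have x: "prime_filter x"
    using nuclear_setsD(2)[OF F] by (auto simp: topspace_esakia_space)
  ultimately show "x \<in> nucleus_set (nuclear_nucleus F)"
    by (simp add: nucleus_set_def nuclear_nucleus_mem_iff[OF F x])
next
  fix x assume "x \<in> nucleus_set (nuclear_nucleus F)"
  then have x: "prime_filter x" and fix_x: "\<And>a. nuclear_nucleus F a \<in> x \<Longrightarrow> a \<in> x"
    by (simp_all add: nucleus_set_def)
  show "x \<in> F"
  proof (rule ccontr)
    assume "x \<notin> F"
    then have "x \<in> topspace esakia_space - F" using x by (simp add: topspace_esakia_space)
    moreover have "openin esakia_space (topspace esakia_space - F)"
      using nuclear_setsD(1)[OF F] by (simp add: closedin_def)
    ultimately obtain p q where x_pq: "x \<in> prime_filters_of p - prime_filters_of q"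
      and disj: "prime_filters_of p - prime_filters_of q \<subseteq> topspace esakia_space - F"
      by (meson openin_esakia_spaceD)
    have "q \<in> y" if y: "y \<in> F" "x \<subseteq> y" for y
    proof -
      have "y \<notin> prime_filters_of p - prime_filters_of q" using disj y(1) by auto
      moreover have "prime_filter y"
        using y(1) nuclear_setsD(2)[OF F] by (auto simp: topspace_esakia_space)
      ultimately show ?thesis using x_pq y(2) by (auto simp: prime_filters_of_def)
    qed
    then have "nuclear_nucleus F q \<in> x" by (simp add: nuclear_nucleus_mem_iff[OF F x])
    then have "q \<in> x" by (rule fix_x)
    then show False using x x_pq by (simp add: prime_filters_of_def)
  qed
qed

text \<open>The order reversal in the form needed for joins: a nuclear set inside the sets of two
  nuclei yields an upper bound of both.\<close>

lemma nucleus_le_nuclear_nucleus: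
  assumes H: "H \<in> nuclear_sets" and sub: "H \<subseteq> nucleus_set k"
  shows "k a \<le> nuclear_nucleus H a"
proof (rule le_prime_filterI)
  fix x assume x: "prime_filter x" "k a \<in> x"
  have "a \<in> y" if "y \<in> H" "x \<subseteq> y" for y
    using that x(2) sub by (auto simp: nucleus_set_def)
  then show "nuclear_nucleus H a \<in> x" by (simp add: nuclear_nucleus_mem_iff[OF H x(1)])
qed

text \<open>Frames are distributive, so complements alone suffice; the difference is the meet with a
  chosen complement.\<close>

lemma boolean_frame_iff:
  "boolean_frame TYPE('b::frame) \<longleftrightarrow> (\<forall>a::'b. \<exists>b. inf a b = bot \<and> sup a b = top)"
proof
  assume "boolean_frame TYPE('b)"
  then obtain minus and uminus :: "'b \<Rightarrow> 'b"
    where ba: "class.boolean_algebra minus uminus inf (\<le>) (<) sup (bot :: 'b) top"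
    unfolding boolean_frame_def by metis
  show "\<forall>a::'b. \<exists>b. inf a b = bot \<and> sup a b = top"
    using boolean_algebra.inf_compl_bot[OF ba] boolean_algebra.sup_compl_top[OF ba] by metis
next
  assume "\<forall>a::'b. \<exists>b. inf a b = bot \<and> sup a b = top"
  then obtain c :: "'b \<Rightarrow> 'b" where "\<And>a. inf a (c a) = bot" "\<And>a. sup a (c a) = top"
    by metis
  then have "class.boolean_algebra (\<lambda>a b. inf a (c b)) c inf (\<le>) (<) sup (bot :: 'b) top"
    by unfold_locales simp_all
  then show "boolean_frame TYPE('b)"
    unfolding boolean_frame_def by metis
qed

subsection \<open>Regular closed sets\<close>

lemma regular_closed_closure_of_open:
  assumes "openin X U"
  shows "X closure_of U \<in> regular_closed_sets X"
  unfolding regular_closed_sets_def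
proof (intro CollectI conjI)
  show "X closure_of U \<subseteq> topspace X" by (rule closure_of_subset_topspace)
  have "U \<subseteq> X interior_of (X closure_of U)"
    using assms by (simp add: interior_of_maximal closure_of_subset openin_subset)
  then have "X closure_of U \<subseteq> X closure_of (X interior_of (X closure_of U))"
    by (rule closure_of_mono)
  moreover have "X closure_of (X interior_of (X closure_of U)) \<subseteq> X closure_of U"
    by (rule closure_of_minimal[OF interior_of_subset closedin_closure_of])
  ultimately show "X closure_of U = X closure_of (X interior_of (X closure_of U))" by blast
qed

lemma in_closure_of_esakia:
  assumes x: "prime_filter x"
  shows "x \<in> esakia_space closure_of S \<longleftrightarrow>
    (\<forall>p q. p \<in> x \<longrightarrow> q \<notin> x \<longrightarrow> (prime_filters_of p - prime_filters_of q) \<inter> S \<noteq> {})"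
    (is "_ \<longleftrightarrow> ?R")
proof
  assume cl: "x \<in> esakia_space closure_of S"
  show ?R
  proof (intro allI impI)
    fix p q assume "p \<in> x" "q \<notin> x"
    then have "x \<in> prime_filters_of p - prime_filters_of q"
      using x by (simp add: prime_filters_of_def)
    then show "(prime_filters_of p - prime_filters_of q) \<inter> S \<noteq> {}"
      using cl openin_esakia_space_basic[of p q] unfolding in_closure_of by blast
  qed
next
  assume R: ?R
  show "x \<in> esakia_space closure_of S"
    unfolding in_closure_of
  proof (intro conjI allI impI)
    show "x \<in> topspace esakia_space" using x by (simp add: topspace_esakia_space)
    fix T assume "x \<in> T \<and> openin esakia_space T"
    then obtain p q where pq: "x \<in> prime_filters_of p - prime_filters_of q"
      "prime_filters_of p - prime_filters_of q \<subseteq> T"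
      by (meson openin_esakia_spaceD)
    have "p \<in> x" "q \<notin> x" using pq(1) x by (simp_all add: prime_filters_of_def)
    then have "(prime_filters_of p - prime_filters_of q) \<inter> S \<noteq> {}" using R by simp
    then show "\<exists>y. y \<in> S \<and> y \<in> T" using pq(2) by blast
  qed
qed

text \<open>A point omitting the element \<open>a\<close> constructed below extends to a filter
  maximal among those omitting \<open>a\<close>, and this filter is a limit of points of
  \<open>W\<close>.\<close>

lemma downset_of_closure_of_open:
  assumes W: "openin esakia_space W"
  obtains a where "downset_of (esakia_space closure_of W) = topspace esakia_space - prime_filters_of a"
proof -
  let ?P = "{himp p q | p q. prime_filters_of p - prime_filters_of q \<subseteq> W}"
  \<comment> \<open>The largest element whose set misses \<open>W\<close>: missing
    \<open>prime_filters_of p - prime_filters_of q\<close> means lying below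
    \<open>himp p q\<close>.\<close>
  define a where "a = Inf ?P"
  have "downset_of (esakia_space closure_of W) = topspace esakia_space - prime_filters_of a"
  proof (intro equalityI subsetI)
    fix x assume "x \<in> downset_of (esakia_space closure_of W)"
    then obtain y where x: "x \<in> topspace esakia_space" and y: "y \<in> esakia_space closure_of W" "x \<subseteq> y"
      by (auto simp: downset_of_def)
    then have prime: "prime_filter y"
      by (auto simp: in_closure_of topspace_esakia_space)
    have "a \<notin> y"
    proof
      assume "a \<in> y"
      then have "(prime_filters_of a - prime_filters_of bot) \<inter> W \<noteq> {}"
        using y(1) prime_filterD(3)[OF prime] unfolding in_closure_of_esakia[OF prime] by simp
      then obtain z where z: "prime_filter z" "a \<in> z" "z \<in> W"
        by (auto simp: prime_filters_of_def)
      obtain p q where pq: "z \<in> prime_filters_of p - prime_filters_of q"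
        "prime_filters_of p - prime_filters_of q \<subseteq> W"
        using openin_esakia_spaceD[OF W z(3)] by metis
      have "a \<le> himp p q" unfolding a_def by (rule Inf_lower) (use pq(2) in blast)
      then have "himp p q \<in> z" using prime_filterD(2)[OF z(1,2)] by metis
      then show False
        using pq(1) z(1) prime_filter_himpD[OF z(1), of p q] by (simp add: prime_filters_of_def)
    qed
    then show "x \<in> topspace esakia_space - prime_filters_of a"
      using x y(2) by (auto simp: prime_filters_of_def)
  next
    fix x assume "x \<in> topspace esakia_space - prime_filters_of a"
    then have x: "prime_filter x" "a \<notin> x"
      by (simp_all add: topspace_esakia_space prime_filters_of_def)
    obtain y where y: "prime_filter y" "x \<subseteq> y" "a \<notin> y"
      and max: "\<forall>c. c \<notin> y \<longrightarrow> (\<exists>z\<in>y. inf z c \<le> a)"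
      by (rule prime_filter_separation_le[OF prime_filter_imp_lattice_filter[OF x(1)] x(2)])
    \<comment> \<open>Suppose a basic neighbourhood of \<open>y\<close> misses \<open>W\<close>.
      Maximality gives \<open>z \<in> y\<close> with \<open>inf z q \<le> a\<close>. Points of
      \<open>W\<close> containing \<open>p\<close> and \<open>z\<close> contain \<open>q\<close>,
      hence \<open>a\<close>, which is impossible; so \<open>inf p z\<close> misses \<open>W\<close>
      and lies below \<open>a\<close>, although it belongs to \<open>y\<close>.\<close>
    have "y \<in> esakia_space closure_of W"
      unfolding in_closure_of_esakia[OF y(1)]
    proof (intro allI impI notI)
      fix p q assume p: "p \<in> y" and q: "q \<notin> y"
        and disj: "(prime_filters_of p - prime_filters_of q) \<inter> W = {}"
      obtain z where z: "z \<in> y" "inf z q \<le> a" using max q by metis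
      have "inf p z \<le> a"
        unfolding a_def
      proof (rule Inf_greatest)
        fix e assume "e \<in> ?P"
        then obtain r s where e: "e = himp r s" and rs: "prime_filters_of r - prime_filters_of s \<subseteq> W"
          by blast
        have "a \<le> e" unfolding a_def by (rule Inf_lower) fact
        have "s \<in> w" if w: "prime_filter w" "inf r (inf p z) \<in> w" for w
        proof (rule ccontr)
          assume s: "s \<notin> w"
          have rpz: "r \<in> w" "p \<in> w" "z \<in> w" using w by (simp_all add: prime_filterD(4)[OF w(1)])
          then have "w \<in> W" using s rs w(1) by (auto simp: prime_filters_of_def)
          then have "q \<in> w" using disj rpz(2) w(1) by (auto simp: prime_filters_of_def)
          then have "inf z q \<in> w" using rpz(3) by (simp add: prime_filterD(4)[OF w(1)])
          then have "himp r s \<in> w"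
            using prime_filterD(2)[OF w(1)] z(2) \<open>a \<le> e\<close> unfolding e by metis
          then show False using prime_filter_himpD[OF w(1)] rpz(1) s by metis
        qed
        then show "inf p z \<le> e" unfolding e le_himp_iff by (intro le_prime_filterI)
      qed
      moreover have "inf p z \<in> y" using p z(1) by (simp add: prime_filterD(4)[OF y(1)])
      ultimately show False using y(3) prime_filterD(2)[OF y(1)] by metis
    qed
    then show "x \<in> downset_of (esakia_space closure_of W)"
      using x(1) y(2) by (auto simp: downset_of_def topspace_esakia_space)
  qed
  then show ?thesis by (rule that)
qed

text \<open>The trace of \<open>F\<close> on a clopen set is the closure of the trace of its
  interior, so the downset formula for closures of open sets applies.\<close>

lemma regular_closed_subset_nuclear: "regular_closed_sets esakia_space \<subseteq> nuclear_sets"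
proof
  fix F :: "'a::frame set set" assume "F \<in> regular_closed_sets esakia_space"
  then have F: "F = esakia_space closure_of (esakia_space interior_of F)"
    by (simp add: regular_closed_sets_def)
  show "F \<in> nuclear_sets"
  proof (rule nuclear_setsI)
    show closed: "closedin esakia_space F" by (subst F) (rule closedin_closure_of)
    fix p q :: 'a
    let ?U = "prime_filters_of p - prime_filters_of q" and ?W = "esakia_space interior_of F"
    have U: "openin esakia_space ?U" "closedin esakia_space ?U"
      using clopenin_Diff[OF clopenin_prime_filters_of clopenin_prime_filters_of, of p q]
      by (simp_all add: clopenin_def)
    have "?U \<inter> F = esakia_space closure_of (?U \<inter> ?W)"
    proof
      show "?U \<inter> F \<subseteq> esakia_space closure_of (?U \<inter> ?W)"
        by (subst F) (rule openin_Int_closure_of_subset[OF U(1)])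
      have "?U \<inter> ?W \<subseteq> ?U \<inter> F" using interior_of_subset[of esakia_space F] by blast
      then show "esakia_space closure_of (?U \<inter> ?W) \<subseteq> ?U \<inter> F"
        by (rule closure_of_minimal) (rule closedin_Int[OF U(2) closed])
    qed
    moreover obtain a where "downset_of (esakia_space closure_of (?U \<inter> ?W))
        = topspace esakia_space - prime_filters_of a"
      by (rule downset_of_closure_of_open[OF openin_Int[OF U(1) openin_interior_of]])
    ultimately show "clopenin esakia_space (downset_of (?U \<inter> F))"
      by (simp add: clopenin_complement clopenin_prime_filters_of)
  qed
qed

section \<open>Complements of nuclei and regular closedness\<close>

lemma is_nucleus_apply: "is_nucleus (apply_nucleus j)"
  using apply_nucleus[of j] by simp

lemma apply_nucleus_bot: "apply_nucleus bot a = a"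
proof (rule antisym)
  have "is_nucleus (id :: 'a \<Rightarrow> 'a)" by (simp add: is_nucleus_def)
  then have "apply_nucleus (Nucleus id) = (id :: 'a \<Rightarrow> 'a)" by (simp add: Nucleus_inverse)
  moreover have "bot \<le> (Nucleus id :: 'a nucleus)" by simp
  ultimately show "apply_nucleus bot a \<le> a" unfolding less_eq_nucleus.rep_eq by simp
qed (rule is_nucleusD(1)[OF is_nucleus_apply])

lemma apply_nucleus_top: "apply_nucleus top a = top"
proof -
  have "is_nucleus (\<lambda>_::'a. top :: 'a)" by (simp add: is_nucleus_def)
  then have "apply_nucleus (Nucleus (\<lambda>_. top)) = (\<lambda>_::'a. top :: 'a)" by (simp add: Nucleus_inverse)
  moreover have "(Nucleus (\<lambda>_. top) :: 'a nucleus) \<le> top" by simp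
  ultimately show ?thesis unfolding less_eq_nucleus.rep_eq by (simp add: top_unique)
qed

lemma nuclear_regular_closed_if_boolean:
  assumes bool: "boolean_frame TYPE('a::frame nucleus)" and F: "(F :: 'a set set) \<in> nuclear_sets"
  shows "F \<in> regular_closed_sets esakia_space"
proof -
  define j where "j = Nucleus (nuclear_nucleus F)"
  have j: "nucleus_set (apply_nucleus j) = F"
    unfolding j_def
    by (simp add: Nucleus_inverse is_nucleus_nuclear_nucleus[OF F] nucleus_set_nuclear_nucleus[OF F])
  obtain k where k: "inf j k = bot" "sup j k = top"
    using bool unfolding boolean_frame_iff by metis
  let ?G = "nucleus_set (apply_nucleus k)"
  have cover: "x \<in> F \<or> x \<in> ?G" if x: "prime_filter x" for x
  proof (rule ccontr)
    assume "\<not> (x \<in> F \<or> x \<in> ?G)"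
    then obtain a b where ab: "apply_nucleus j a \<in> x" "a \<notin> x" "apply_nucleus k b \<in> x" "b \<notin> x"
      using x unfolding j[symmetric] by (auto simp: nucleus_set_def)
    \<comment> \<open>The join witnesses both failures at once: \<open>j\<close> and
      \<open>k\<close> each move it into \<open>x\<close>, hence so does their meet, the identity
      nucleus.\<close>
    let ?c = "sup a b"
    have "apply_nucleus j ?c \<in> x" "apply_nucleus k ?c \<in> x"
      using ab(1,3) prime_filterD(2)[OF x] is_nucleus_mono[OF is_nucleus_apply]
      by (metis sup_ge1, metis sup_ge2)
    then have "apply_nucleus (inf j k) ?c \<in> x"
      by (simp add: apply_nucleus_inf prime_filterD(4)[OF x])
    then show False using ab(2,4) by (simp add: k apply_nucleus_bot prime_filterD(5)[OF x])
  qed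
  \<comment> \<open>The nucleus of such an \<open>H\<close> bounds \<open>j\<close> and
    \<open>k\<close>, so it is \<open>top\<close>; a point of \<open>H\<close> would then be fixed
    by it and contain \<open>bot\<close>.\<close>
  have disjoint: "H = {}" if H: "H \<in> nuclear_sets" "H \<subseteq> F" "H \<subseteq> ?G" for H
  proof (rule ccontr)
    assume "H \<noteq> {}"
    then obtain x where x: "x \<in> H" by blast
    define h where "h = Nucleus (nuclear_nucleus H)"
    have h: "apply_nucleus h = nuclear_nucleus H"
      unfolding h_def by (simp add: Nucleus_inverse is_nucleus_nuclear_nucleus[OF H(1)])
    have "j \<le> h" "k \<le> h"
      using nucleus_le_nuclear_nucleus[OF H(1)] H(2,3) j
      unfolding less_eq_nucleus.rep_eq h by metis+
    then have "sup j k \<le> h" by (rule sup_least)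
    then have "h = top" by (simp add: k top_unique)
    then have "nuclear_nucleus H bot = top"
      using h apply_nucleus_top by metis
    moreover have "x \<in> nucleus_set (nuclear_nucleus H)"
      using x nucleus_set_nuclear_nucleus[OF H(1)] by simp
    ultimately show False
      using prime_filterD(1,3)[of x] unfolding nucleus_set_def mem_Collect_eq by metis
  qed
  let ?W = "esakia_space interior_of F"
  have "F \<subseteq> esakia_space closure_of ?W"
  proof
    fix x assume xF: "x \<in> F"
    then have x: "prime_filter x"
      using nuclear_setsD(2)[OF F] by (auto simp: topspace_esakia_space)
    show "x \<in> esakia_space closure_of ?W"
      unfolding in_closure_of_esakia[OF x]
    proof (intro allI impI notI)
      fix p q assume pq: "p \<in> x" "q \<notin> x"
      let ?V = "prime_filters_of p - prime_filters_of q"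
      assume VW: "?V \<inter> ?W = {}"
      \<comment> \<open>The complement of \<open>?G\<close> is open and inside \<open>F\<close>,
        hence inside the interior. So a neighbourhood missing the interior meets \<open>F\<close>
        only within \<open>?G\<close>.\<close>
      have "openin esakia_space (topspace esakia_space - ?G)"
        by (simp add: openin_diff closedin_nucleus_set)
      moreover have "topspace esakia_space - ?G \<subseteq> F"
        using cover by (auto simp: topspace_esakia_space)
      ultimately have "topspace esakia_space - ?G \<subseteq> ?W" by (simp add: interior_of_maximal)
      then have "?V \<inter> F \<subseteq> ?G"
        using VW nuclear_setsD(2)[OF F] by blast
      moreover have "?V \<inter> F \<in> nuclear_sets"
        by (intro nuclear_Int_clopen F clopenin_Diff clopenin_prime_filters_of)
      ultimately have "?V \<inter> F = {}" by (intro disjoint) simp_all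
      moreover have "x \<in> ?V" using x pq by (simp add: prime_filters_of_def)
      ultimately show False using xF by blast
    qed
  qed
  moreover have "esakia_space closure_of ?W \<subseteq> F"
    by (rule closure_of_minimal[OF interior_of_subset nuclear_setsD(1)[OF F]])
  ultimately show ?thesis
    using nuclear_setsD(2)[OF F] unfolding regular_closed_sets_def by blast
qed

text \<open>Since \<open>?F\<close> and \<open>?G\<close> cover the space, the meet is
  \<open>bot\<close>. The set of the join lies in \<open>?F \<inter> ?G\<close>, which has empty
  interior; being regular closed, it is empty.\<close>

lemma boolean_if_nuclear_regular_closed:
  assumes eq: "(nuclear_sets :: 'a::frame set set set) = regular_closed_sets esakia_space"
  shows "boolean_frame TYPE('a nucleus)"
  unfolding boolean_frame_iff
proof
  fix j :: "'a nucleus"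
  let ?F = "nucleus_set (apply_nucleus j)"
  let ?G = "esakia_space closure_of (topspace esakia_space - ?F)"
  have open_F: "openin esakia_space (topspace esakia_space - ?F)"
    by (simp add: openin_diff closedin_nucleus_set)
  then have G: "?G \<in> nuclear_sets"
    unfolding eq by (rule regular_closed_closure_of_open)
  define k where "k = Nucleus (nuclear_nucleus ?G)"
  have "apply_nucleus k = nuclear_nucleus ?G"
    unfolding k_def by (simp add: Nucleus_inverse is_nucleus_nuclear_nucleus[OF G])
  then have k: "nucleus_set (apply_nucleus k) = ?G"
    by (simp add: nucleus_set_nuclear_nucleus[OF G])
  have "inf j k = bot"
  proof (rule bot_unique[THEN iffD1])
    have "inf (apply_nucleus j a) (apply_nucleus k a) \<le> a" for a
    proof (rule le_prime_filterI)
      fix x assume x: "prime_filter x" "inf (apply_nucleus j a) (apply_nucleus k a) \<in> x"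
      have "topspace esakia_space - ?F \<subseteq> ?G" by (rule closure_of_subset) blast
      then have "x \<in> ?F \<or> x \<in> nucleus_set (apply_nucleus k)"
        unfolding k using x(1) by (auto simp: topspace_esakia_space)
      then show "a \<in> x" using x by (auto simp: nucleus_set_def prime_filterD(4))
    qed
    then show "inf j k \<le> bot"
      by (simp add: less_eq_nucleus.rep_eq apply_nucleus_inf apply_nucleus_bot)
  qed
  moreover have "sup j k = top"
  proof -
    let ?m = "sup j k"
    let ?M = "nucleus_set (apply_nucleus ?m)"
    have "?M \<subseteq> nucleus_set (apply_nucleus l)" if "l \<le> ?m" for l
    proof
      fix x assume x: "x \<in> ?M"
      then have prime: "prime_filter x" by (simp add: nucleus_set_def)
      have "a \<in> x" if a: "apply_nucleus l a \<in> x" for a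
      proof -
        have "apply_nucleus ?m a \<in> x"
          using prime_filterD(2)[OF prime a] \<open>l \<le> ?m\<close> by (simp add: less_eq_nucleus.rep_eq)
        then show ?thesis using x by (simp add: nucleus_set_def)
      qed
      then show "x \<in> nucleus_set (apply_nucleus l)" using prime by (simp add: nucleus_set_def)
    qed
    from this[of j] this[of k] have sub: "?M \<subseteq> ?F" "?M \<subseteq> ?G" unfolding k by simp_all
    let ?I = "esakia_space interior_of ?M"
    have "?I \<inter> (topspace esakia_space - ?F) = {}"
      using sub(1) interior_of_subset[of esakia_space ?M] by blast
    then have "?I \<inter> ?G = {}"
      by (simp add: openin_Int_closure_of_eq_empty)
    then have "?I = {}"
      using sub(2) interior_of_subset[of esakia_space ?M] by blast
    moreover have "?M \<in> regular_closed_sets esakia_space"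
      unfolding eq[symmetric] by (rule nuclear_nucleus_set[OF is_nucleus_apply])
    ultimately have "?M = {}"
      unfolding regular_closed_sets_def by simp
    \<comment> \<open>Any prime filter omitting a value of \<open>?m\<close> would lie below a fixed
      one.\<close>
    have "top \<le> apply_nucleus ?m a" for a
    proof (rule le_prime_filterI, rule ccontr)
      fix x assume "prime_filter x" "apply_nucleus ?m a \<notin> x"
      then obtain y where "y \<in> ?M"
        using nucleus_set_separation[OF is_nucleus_apply] by metis
      then show False using \<open>?M = {}\<close> by simp
    qed
    then have "top \<le> ?m" by (simp add: less_eq_nucleus.rep_eq apply_nucleus_top)
    then show ?thesis by (simp add: top_unique)
  qed
  ultimately show "\<exists>k. inf j k = bot \<and> sup j k = top" by blast
qed

subsection \<open>Maximal points\<close>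

text \<open>A larger point that contains \<open>b\<close> and still omits \<open>a\<close> exists
  exactly when \<open>himp b a \<notin> x\<close>. Maximality therefore means that every
  \<open>b\<close> outside \<open>x\<close> has \<open>himp b a\<close> in \<open>x\<close>.\<close>

lemma maximal_points_iff:
  "x \<in> maximal_points (topspace esakia_space - prime_filters_of a) \<longleftrightarrow>
    prime_filter x \<and> a \<notin> x \<and> (\<forall>b. sup b (himp b a) \<in> x)" (is "_ \<longleftrightarrow> ?R")
proof
  assume "x \<in> maximal_points (topspace esakia_space - prime_filters_of a)"
  then have x: "prime_filter x" "a \<notin> x"
    and max: "\<And>y. prime_filter y \<Longrightarrow> a \<notin> y \<Longrightarrow> x \<subseteq> y \<Longrightarrow> y = x"
    by (auto simp: maximal_points_def topspace_esakia_space prime_filters_of_def)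
  have "b \<in> x \<or> himp b a \<in> x" for b
  proof (rule disjCI)
    assume "himp b a \<notin> x"
    with x(1) obtain y where "prime_filter y" "x \<subseteq> y" "b \<in> y" "a \<notin> y"
      by (rule prime_filter_himp_separation)
    then show "b \<in> x" using max by metis
  qed
  then show ?R using x by (simp add: prime_filterD(5)[OF x(1)])
next
  assume R: ?R
  have "y = x" if y: "prime_filter y" "a \<notin> y" "x \<subseteq> y" for y
  proof (rule antisym[OF subsetI y(3)])
    fix b assume b: "b \<in> y"
    have "b \<in> x \<or> himp b a \<in> x" using R by (metis prime_filterD(5))
    then show "b \<in> x" using prime_filter_himpD[OF y(1) _ b, of a] y(2,3) by (meson subsetD)
  qed
  then show "x \<in> maximal_points (topspace esakia_space - prime_filters_of a)"
    using R by (auto simp: maximal_points_def topspace_esakia_space prime_filters_of_def)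
qed

text \<open>A filter maximal among all filters omitting \<open>a\<close> works: for \<open>b\<close>
  outside it, the element \<open>z\<close> with \<open>inf z b \<le> a\<close> lies below
  \<open>himp b a\<close>.\<close>

lemma maximal_point_above:
  assumes x: "prime_filter x" "a \<notin> x"
  obtains y where "y \<in> maximal_points (topspace esakia_space - prime_filters_of a)" "x \<subseteq> y"
proof -
  obtain y where y: "prime_filter y" "x \<subseteq> y" "a \<notin> y"
    and max: "\<forall>c. c \<notin> y \<longrightarrow> (\<exists>z\<in>y. inf z c \<le> a)"
    by (rule prime_filter_separation_le[OF prime_filter_imp_lattice_filter[OF x(1)] x(2)])
  have "b \<in> y \<or> himp b a \<in> y" for b
  proof (cases "b \<in> y")
    case False
    then obtain z where "z \<in> y" "inf z b \<le> a" using max by metis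
    then have "himp b a \<in> y"
      using prime_filterD(2)[OF y(1)] by (metis inf_commute le_himp_iff)
    then show ?thesis ..
  qed simp
  then show ?thesis
    using that[of y] y unfolding maximal_points_iff by (simp add: prime_filterD(5)[OF y(1)])
qed

text \<open>Near a point of \<open>F\<close>, the maximal points of the clopen downset
  \<open>?D\<close> form a nonempty open set. Each lies below a point of
  \<open>?H \<subseteq> ?D\<close> and so equals it; thus the neighbourhood meets the interior of
  \<open>F\<close>.\<close>

lemma nuclear_eq_regular_closed_if_clopen_max:
  assumes clopen_max: "\<And>D :: 'a::frame set set. clopenin esakia_space D \<Longrightarrow> D = downset_of D
    \<Longrightarrow> clopenin esakia_space (maximal_points D)"
  shows "(nuclear_sets :: 'a set set set) = regular_closed_sets esakia_space"
proof (rule antisym[OF subsetI regular_closed_subset_nuclear])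
  fix F :: "'a set set" assume F: "F \<in> nuclear_sets"
  let ?W = "esakia_space interior_of F"
  have "F \<subseteq> esakia_space closure_of ?W"
  proof
    fix x assume xF: "x \<in> F"
    then have x: "prime_filter x"
      using nuclear_setsD(2)[OF F] by (auto simp: topspace_esakia_space)
    show "x \<in> esakia_space closure_of ?W"
      unfolding in_closure_of_esakia[OF x]
    proof (intro allI impI)
      fix p q assume pq: "p \<in> x" "q \<notin> x"
      let ?V = "prime_filters_of p - prime_filters_of q"
      let ?H = "?V \<inter> F"
      let ?D = "downset_of ?H"
      have V: "clopenin esakia_space ?V"
        by (intro clopenin_Diff clopenin_prime_filters_of)
      have D: "clopenin esakia_space ?D" "?D = downset_of ?D"
        by (simp_all add: downset_of_idem nuclear_setsD(3)[OF F V])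
      then obtain a where a: "?D = topspace esakia_space - prime_filters_of a"
        by (rule clopenin_downset)
      have H_D: "?H \<subseteq> ?D"
        using nuclear_setsD(2)[OF F] by (intro subset_downset_of) blast
      have max_H: "maximal_points ?D \<subseteq> ?H"
      proof
        fix y assume y: "y \<in> maximal_points ?D"
        then obtain h where h: "h \<in> ?H" "y \<subseteq> h"
          by (auto simp: maximal_points_def downset_of_def)
        then have "h = y" using y H_D by (auto simp: maximal_points_def)
        then show "y \<in> ?H" using h(1) by simp
      qed
      have "openin esakia_space (maximal_points ?D)"
        using clopen_max[OF D] by (simp add: clopenin_def)
      then have "maximal_points ?D \<subseteq> ?W"
        using max_H by (intro interior_of_maximal) blast
      moreover have "maximal_points ?D \<noteq> {}"
      proof -
        have "x \<in> ?D" using H_D x xF pq by (auto simp: prime_filters_of_def)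
        then have "a \<notin> x" using x unfolding a by (simp add: prime_filters_of_def)
        with x show ?thesis unfolding a by (rule maximal_point_above) blast
      qed
      ultimately show "?V \<inter> ?W \<noteq> {}" using max_H by blast
    qed
  qed
  moreover have "esakia_space closure_of ?W \<subseteq> F"
    by (rule closure_of_minimal[OF interior_of_subset nuclear_setsD(1)[OF F]])
  ultimately show "F \<in> regular_closed_sets esakia_space"
    using nuclear_setsD(2)[OF F] unfolding regular_closed_sets_def by blast
qed

lemma le_himp_himp: "b \<le> himp (himp b a) a"
  using le_himp_iff[of "himp b a" b a] by (simp add: le_himp_iff inf_commute)

lemma is_nucleus_double_himp: "is_nucleus (\<lambda>b. himp (himp b a) a)"
  unfolding is_nucleus_def
proof (intro conjI allI)
  fix b c
  have anti: "himp d a \<le> himp b a" if "b \<le> d" for b d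
    unfolding le_himp_iff
    by (rule order_trans[OF inf_mono[OF that order_refl]]) (simp flip: le_himp_iff)
  \<comment> \<open>Modulo \<open>a\<close>, an element disjoint from \<open>d\<close> is disjoint
    from its double negation. Using this once for \<open>c\<close> and once for \<open>b\<close>
    gives preservation of meets.\<close>
  have swap: "inf u (himp (himp d a) a) \<le> a" if "inf u d \<le> a" for u d
  proof -
    have "u \<le> himp d a" using that by (simp add: le_himp_iff inf_commute)
    then have "inf u (himp (himp d a) a) \<le> inf (himp d a) (himp (himp d a) a)"
      by (intro inf_mono order_refl)
    also have "\<dots> \<le> a" by (simp flip: le_himp_iff)
    finally show ?thesis .
  qed
  show "b \<le> himp (himp b a) a" by (rule le_himp_himp)
  show "himp (himp (himp (himp b a) a) a) a \<le> himp (himp b a) a"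
    by (intro anti le_himp_himp)
  show "himp (himp (inf b c) a) a = inf (himp (himp b a) a) (himp (himp c a) a)"
  proof (rule antisym)
    show "himp (himp (inf b c) a) a \<le> inf (himp (himp b a) a) (himp (himp c a) a)"
      by (intro inf_greatest anti) simp_all
    let ?u = "himp (inf b c) a"
    have "inf (inf ?u b) c \<le> a"
      using le_himp_iff[of ?u "inf b c" a] by (simp add: ac_simps)
    then have "inf (inf ?u b) (himp (himp c a) a) \<le> a" by (rule swap)
    then have "inf (inf ?u (himp (himp c a) a)) b \<le> a" by (simp add: ac_simps)
    then have "inf (inf ?u (himp (himp c a) a)) (himp (himp b a) a) \<le> a" by (rule swap)
    then show "inf (himp (himp b a) a) (himp (himp c a) a) \<le> himp (himp (inf b c) a) a"
      by (simp add: le_himp_iff ac_simps)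
  qed
qed

text \<open>Conversely to maximality making \<open>x\<close> fixed: \<open>a\<close> lies below the
  value at \<open>bot\<close>, so a fixed point omits \<open>a\<close>, and
  \<open>sup b (himp b a)\<close> has value \<open>top\<close>, so a fixed point contains
  it.\<close>

lemma maximal_points_eq_nucleus_set:
  "maximal_points (topspace esakia_space - prime_filters_of a) = nucleus_set (\<lambda>b. himp (himp b a) a)"
proof (intro equalityI subsetI)
  fix x assume "x \<in> maximal_points (topspace esakia_space - prime_filters_of a)"
  then have x: "prime_filter x" "a \<notin> x" and max: "\<And>b. b \<in> x \<or> himp b a \<in> x"
    unfolding maximal_points_iff by (auto simp: prime_filterD(5))
  have "b \<in> x" if "himp (himp b a) a \<in> x" for b
    using max[of b] prime_filter_himpD[OF x(1) that] x(2) by metis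
  then show "x \<in> nucleus_set (\<lambda>b. himp (himp b a) a)" using x(1) by (simp add: nucleus_set_def)
next
  fix x assume "x \<in> nucleus_set (\<lambda>b. himp (himp b a) a)"
  then have x: "prime_filter x" and fix_x: "\<And>b. himp (himp b a) a \<in> x \<Longrightarrow> b \<in> x"
    by (simp_all add: nucleus_set_def)
  have "a \<notin> x"
  proof
    assume "a \<in> x"
    moreover have "a \<le> himp (himp bot a) a" by (simp add: le_himp_iff)
    ultimately have "bot \<in> x" using fix_x prime_filterD(2)[OF x] by metis
    then show False using prime_filterD(3)[OF x] by simp
  qed
  moreover have "sup b (himp b a) \<in> x" for b
  proof (rule fix_x)
    let ?e = "sup b (himp b a)"
    let ?h = "himp ?e a"
    have "inf ?e ?h \<le> a" by (simp flip: le_himp_iff)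
    then have "inf b ?h \<le> a" and "inf (himp b a) ?h \<le> a"
      unfolding inf_sup_distrib2 by simp_all
    from this(1) have "?h \<le> himp b a" by (simp add: le_himp_iff)
    with \<open>inf (himp b a) ?h \<le> a\<close> have "?h \<le> a" by (simp add: inf_absorb2)
    then have "top \<le> himp ?h a" by (simp add: le_himp_iff)
    then show "himp ?h a \<in> x" using prime_filterD(1,2)[OF x] by metis
  qed
  ultimately show "x \<in> maximal_points (topspace esakia_space - prime_filters_of a)"
    unfolding maximal_points_iff using x by simp
qed

lemma clopen_max_if_nuclear_eq_regular_closed:
  assumes eq: "(nuclear_sets :: 'a::frame set set set) = regular_closed_sets esakia_space"
    and D: "clopenin esakia_space (D :: 'a set set)" "D = downset_of D"
  shows "clopenin esakia_space (maximal_points D)"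
proof -
  obtain a where a: "D = topspace esakia_space - prime_filters_of a"
    using D by (rule clopenin_downset)
  let ?M = "maximal_points D"
  let ?W = "esakia_space interior_of ?M"
  have "?M \<in> regular_closed_sets esakia_space"
    unfolding a maximal_points_eq_nucleus_set eq[symmetric]
    by (rule nuclear_nucleus_set[OF is_nucleus_double_himp])
  then have M: "?M = esakia_space closure_of ?W"
    by (simp add: regular_closed_sets_def)
  \<comment> \<open>The interior is described by sets bounded from below only by \<open>a\<close>;
    their union, closed up, turns out to be the clopen set of \<open>Sup C\<close> minus that of
    \<open>a\<close>.\<close>
  define C where "C = {c. prime_filters_of c - prime_filters_of a \<subseteq> ?M}"
  let ?U = "prime_filters_of (Sup C) - prime_filters_of a"
  have U: "clopenin esakia_space ?U"
    by (intro clopenin_Diff clopenin_prime_filters_of)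
  have "?W \<subseteq> ?U"
  proof
    fix y assume y: "y \<in> ?W"
    then have yM: "y \<in> ?M" using interior_of_subset[of esakia_space ?M] by blast
    then have prime: "prime_filter y" "a \<notin> y" and max: "\<And>b. b \<in> y \<or> himp b a \<in> y"
      unfolding a maximal_points_iff by (auto simp: prime_filterD(5))
    obtain p q where pq: "y \<in> prime_filters_of p - prime_filters_of q"
      "prime_filters_of p - prime_filters_of q \<subseteq> ?W"
      using openin_esakia_spaceD[OF openin_interior_of y] by metis
    \<comment> \<open>Maximality turns the omission of \<open>q\<close> into the positive condition
      \<open>himp q a \<in> y\<close>; conversely, a point with \<open>himp q a\<close> and without
      \<open>a\<close> omits \<open>q\<close>.\<close>
    let ?c = "inf p (himp q a)"
    have "prime_filters_of ?c - prime_filters_of a \<subseteq> prime_filters_of p - prime_filters_of q"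
      using prime_filter_himpD[of _ q a] by (auto simp: prime_filters_of_def prime_filterD(4))
    then have "?c \<in> C"
      unfolding C_def using pq(2) interior_of_subset[of esakia_space ?M] by blast
    then have "?c \<le> Sup C" by (rule Sup_upper)
    moreover have "?c \<in> y"
      using pq(1) max[of q] prime(1) by (simp add: prime_filters_of_def prime_filterD(4))
    ultimately have "Sup C \<in> y" using prime_filterD(2)[OF prime(1)] by metis
    then show "y \<in> ?U" using prime by (simp add: prime_filters_of_def)
  qed
  then have "esakia_space closure_of ?W \<subseteq> ?U"
    using U by (intro closure_of_minimal) (simp_all add: clopenin_def)
  then have sub: "?M \<subseteq> ?U" using M by simp
  have "y \<in> esakia_space closure_of ?M" if y: "y \<in> ?U" for y
  proof -
    from y have prime: "prime_filter y" "Sup C \<in> y" "a \<notin> y"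
      by (simp_all add: prime_filters_of_def)
    show ?thesis
      unfolding in_closure_of_esakia[OF prime(1)]
    proof (intro allI impI notI)
      fix p q assume pq: "p \<in> y" "q \<notin> y"
        and disj: "(prime_filters_of p - prime_filters_of q) \<inter> ?M = {}"
      \<comment> \<open>A basic set missing \<open>?M\<close> misses the basic set of each
        \<open>c \<in> C\<close>. As an inequality this passes to \<open>Sup C\<close> by the frame
        law.\<close>
      have "inf p c \<le> sup q a" if c: "c \<in> C" for c
      proof (rule le_prime_filterI)
        fix w assume w: "prime_filter w" "inf p c \<in> w"
        have "w \<in> ?M" if "a \<notin> w"
          using c w that unfolding C_def by (auto simp: prime_filters_of_def prime_filterD(4))
        then show "sup q a \<in> w"
          using disj w by (auto simp: prime_filters_of_def prime_filter_simps)
      qed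
      then have "inf p (Sup C) \<le> sup q a"
        unfolding inf_Sup_distrib by (rule SUP_least)
      moreover have "inf p (Sup C) \<in> y" using pq prime by (simp add: prime_filterD(4))
      ultimately have "sup q a \<in> y" using prime_filterD(2)[OF prime(1)] by metis
      then show False using pq(2) prime by (simp add: prime_filterD(5))
    qed
  qed
  moreover have "esakia_space closure_of ?M = ?M" by (metis M closure_of_closure_of)
  ultimately have "?M = ?U" using sub by blast
  then show ?thesis using U by simp
qed

section \<open>Dense elements and scatteredness\<close>

text \<open>If \<open>himp d a \<le> a\<close> fails, some maximal point contains
  \<open>himp d a\<close> and so omits \<open>d\<close>. If \<open>himp d a = a \<le> d\<close>,
  then \<open>d\<close> equals \<open>sup d (himp d a)\<close>, which lies in every maximal
  point.\<close>

lemma dense_in_upset_iff_maximal_points: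
  "dense_in_upset a d \<longleftrightarrow>
    a \<le> d \<and> maximal_points (topspace esakia_space - prime_filters_of a) \<subseteq> prime_filters_of d"
    (is "_ \<longleftrightarrow> _ \<and> ?M \<subseteq> _")
proof (cases "a \<le> d")
  case True
  have "himp d a = a \<longleftrightarrow> ?M \<subseteq> prime_filters_of d"
  proof
    assume d: "himp d a = a"
    show "?M \<subseteq> prime_filters_of d"
    proof
      fix x assume "x \<in> ?M"
      then have "prime_filter x" "sup d (himp d a) \<in> x" unfolding maximal_points_iff by simp_all
      then show "x \<in> prime_filters_of d"
        using True unfolding d by (simp add: sup_absorb1 prime_filters_of_def)
    qed
  next
    assume sub: "?M \<subseteq> prime_filters_of d"
    show "himp d a = a"
    proof (rule antisym)
      show "himp d a \<le> a"
      proof (rule le_prime_filterI, rule ccontr)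
        fix x assume x: "prime_filter x" "himp d a \<in> x" "a \<notin> x"
        from x(1,3) obtain y where y: "y \<in> ?M" "x \<subseteq> y" by (rule maximal_point_above)
        then have "prime_filter y" "a \<notin> y" by (simp_all add: maximal_points_iff)
        moreover have "d \<in> y" using subsetD[OF sub y(1)] by (simp add: prime_filters_of_def)
        ultimately have "prime_filter y" "d \<in> y" "a \<notin> y" by simp_all
        then show False using prime_filter_himpD[of y d a] x(2) y(2) by blast
      qed
    qed (simp add: le_himp_iff)
  qed
  then show ?thesis using True by (simp add: dense_in_upset_iff)
qed (simp add: dense_in_upset_iff)

lemma scattered_if_clopen_max:
  assumes clopen_max: "\<And>D :: 'a::frame set set. clopenin esakia_space D \<Longrightarrow> D = downset_of D
    \<Longrightarrow> clopenin esakia_space (maximal_points D)"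
  shows "scattered_frame TYPE('a)"
  unfolding scattered_frame_def
proof
  fix a :: 'a
  let ?D = "topspace esakia_space - prime_filters_of a"
  let ?M = "maximal_points ?D"
  have D: "clopenin esakia_space ?D"
    by (intro clopenin_complement clopenin_prime_filters_of)
  have down: "?D = downset_of ?D"
    by (auto simp: downset_of_def topspace_esakia_space prime_filters_of_def)
  have "clopenin esakia_space (?D - ?M)"
    by (intro clopenin_Diff D clopen_max down)
  \<comment> \<open>A maximal point has no other point of \<open>?D\<close> above it, so removing
    \<open>?M\<close> keeps a downset. Its element \<open>d\<close> has the set
    \<open>prime_filters_of a \<union> ?M\<close>, the smallest possible for a dense
    element.\<close>
  moreover have "?D - ?M = downset_of (?D - ?M)"
  proof (intro equalityI subset_downset_of subsetI)
    fix x assume "x \<in> downset_of (?D - ?M)"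
    then obtain y where y: "y \<in> ?D" "y \<notin> ?M" "x \<subseteq> y" "x \<in> topspace esakia_space"
      by (auto simp: downset_of_def)
    then have "x \<in> ?D" by (auto simp: topspace_esakia_space prime_filters_of_def)
    moreover have "x \<notin> ?M" using y unfolding maximal_points_def by blast
    ultimately show "x \<in> ?D - ?M" by simp
  qed blast
  ultimately obtain d where d: "?D - ?M = topspace esakia_space - prime_filters_of d"
    by (rule clopenin_downset)
  have "?M \<subseteq> ?D" by (auto simp: maximal_points_def)
  moreover have "prime_filters_of a \<subseteq> topspace esakia_space" "prime_filters_of d \<subseteq> topspace esakia_space"
    by (auto simp: prime_filters_of_def topspace_esakia_space)
  ultimately have eq: "prime_filters_of d = prime_filters_of a \<union> ?M"
    using d by blast
  have "dense_in_upset a d"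
    using prime_filters_of_subset_iff[of a d]
    unfolding dense_in_upset_iff_maximal_points eq by blast
  moreover have "d \<le> e" if "dense_in_upset a e" for e
    using that prime_filters_of_subset_iff[of a e] prime_filters_of_subset_iff[of d e]
    unfolding dense_in_upset_iff_maximal_points eq by blast
  ultimately show "\<exists>d. dense_in_upset a d \<and> (\<forall>e. dense_in_upset a e \<longrightarrow> d \<le> e)" by blast
qed

text \<open>Every \<open>sup b (himp b a)\<close> is dense, so the least dense \<open>d\<close> lies
  below all of them. A point that contains \<open>d\<close> but omits \<open>a\<close> thus contains
  them all and is maximal.\<close>

lemma clopen_max_if_scattered:
  assumes scattered: "scattered_frame TYPE('a::frame)"
    and D: "clopenin esakia_space (D :: 'a set set)" "D = downset_of D"
  shows "clopenin esakia_space (maximal_points D)"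
proof -
  obtain a where a: "D = topspace esakia_space - prime_filters_of a"
    using D by (rule clopenin_downset)
  obtain d where d: "dense_in_upset a d" and least: "\<And>e. dense_in_upset a e \<Longrightarrow> d \<le> e"
    using scattered unfolding scattered_frame_def by metis
  have "maximal_points D = prime_filters_of d - prime_filters_of a"
  proof (intro equalityI subsetI)
    fix x assume "x \<in> maximal_points D"
    then show "x \<in> prime_filters_of d - prime_filters_of a"
      using d unfolding dense_in_upset_iff_maximal_points a
      by (auto simp: maximal_points_def)
  next
    fix x assume "x \<in> prime_filters_of d - prime_filters_of a"
    then have x: "prime_filter x" "d \<in> x" "a \<notin> x" by (simp_all add: prime_filters_of_def)
    have "sup b (himp b a) \<in> x" for b
    proof -
      have "a \<le> himp b a" by (simp add: le_himp_iff)
      then have "a \<le> sup b (himp b a)" by (rule le_supI2)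
      moreover have "maximal_points (topspace esakia_space - prime_filters_of a)
          \<subseteq> prime_filters_of (sup b (himp b a))"
      proof
        fix y assume "y \<in> maximal_points (topspace esakia_space - prime_filters_of a)"
        then show "y \<in> prime_filters_of (sup b (himp b a))"
          unfolding maximal_points_iff by (simp add: prime_filters_of_def)
      qed
      ultimately have "dense_in_upset a (sup b (himp b a))"
        by (simp add: dense_in_upset_iff_maximal_points)
      then show ?thesis using least prime_filterD(2)[OF x(1,2)] by metis
    qed
    then show "x \<in> maximal_points D" unfolding a maximal_points_iff using x by simp
  qed
  then show ?thesis by (simp add: clopenin_Diff clopenin_prime_filters_of)
qed

theorem theorem6p1:
  shows "(boolean_frame TYPE('a::frame nucleus) \<longleftrightarrow>
          (nuclear_sets :: 'a set set set) = regular_closed_sets esakia_space) \<and>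
         ((nuclear_sets :: 'a set set set) = regular_closed_sets esakia_space \<longleftrightarrow>
          (\<forall>D :: 'a set set. clopenin esakia_space D \<and> D = downset_of D
             \<longrightarrow> clopenin esakia_space (maximal_points D))) \<and>
         ((\<forall>D :: 'a set set. clopenin esakia_space D \<and> D = downset_of D
             \<longrightarrow> clopenin esakia_space (maximal_points D)) \<longleftrightarrow>
          scattered_frame TYPE('a))"
proof (intro conjI iffI)
  assume "boolean_frame TYPE('a nucleus)"
  then show "(nuclear_sets :: 'a set set set) = regular_closed_sets esakia_space"
    by (intro antisym subsetI regular_closed_subset_nuclear nuclear_regular_closed_if_boolean)
next
  assume "(nuclear_sets :: 'a set set set) = regular_closed_sets esakia_space"
  then show "boolean_frame TYPE('a nucleus)"
    by (rule boolean_if_nuclear_regular_closed)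
next
  assume "(nuclear_sets :: 'a set set set) = regular_closed_sets esakia_space"
  then show "\<forall>D :: 'a set set. clopenin esakia_space D \<and> D = downset_of D
      \<longrightarrow> clopenin esakia_space (maximal_points D)"
    by (metis clopen_max_if_nuclear_eq_regular_closed)
next
  assume "\<forall>D :: 'a set set. clopenin esakia_space D \<and> D = downset_of D
      \<longrightarrow> clopenin esakia_space (maximal_points D)"
  then show "(nuclear_sets :: 'a set set set) = regular_closed_sets esakia_space"
    by (intro nuclear_eq_regular_closed_if_clopen_max) simp
next
  assume "\<forall>D :: 'a set set. clopenin esakia_space D \<and> D = downset_of D
      \<longrightarrow> clopenin esakia_space (maximal_points D)"
  then show "scattered_frame TYPE('a)"
    by (intro scattered_if_clopen_max) simp
next
  assume "scattered_frame TYPE('a)"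
  then show "\<forall>D :: 'a set set. clopenin esakia_space D \<and> D = downset_of D
      \<longrightarrow> clopenin esakia_space (maximal_points D)"
    by (metis clopen_max_if_scattered)
qed

end
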